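(* Let $G=((P\oplus C)\rtimes N)\rtimes K$ be an extended Heisenberg group. Then $\{n,k,R,S\}$ is a full system of invariants of conjugacy classes in $G$: two elements $x_1=(p_1,c_1,n_1,k_1)$ and $x_2=(p_2,c_2,n_2,k_2)$ of $G$ are conjugate in $G$ if and only if $n_1=n_2$, $k_1=k_2$, $R(x_1)=R(x_2)$ in $P/\operatorname{Im}\Lambda$, and $S(x_1)=S(x_2)$ in $(C/\operatorname{Im} n)/V$ (where $\Lambda$, $\operatorname{Im} n$ and $V$ are those attached to the common values $n=n_1=n_2$, $k=k_1=k_2$ and $r=R(x_1)=R(x_2)$).
   Context: Extended Heisenberg group. $N,P,C$ are abelian groups (written additively) with a bilinear pairing $N\times P\to C$, $(n,p)\mapsto n(p)$. $N$ acts on $P\oplus C$ by $n(p,c)=(p,c+n(p))$, giving the Heisenberg group $(P\oplus C)\rtimes N$. An automorphism of a semidirect product $A\rtimes B$ is called graded if it preserves the filtration $1\subset A\subset A\rtimes B$ and acts trivially on the quotients $A$ and $(A\rtimes B)/A$. Each graded automorphism $k$ of $(P\oplus C)\rtimes N$ is given by a pair $(k_p,k_c)$, where $k_p:N\to P$ is a homomorphism and $k_c:N\to C$ is a map with $k_c(n_1+n_2)=k_c(n_1)+k_c(n_2)+n_1(k_p(n_2))$ for all $n_1,n_2\in N$; it acts by $k(p,c,n)=(p+k_p(n),c+k_c(n),n)$. These automorphisms form an abelian group $\mathrm{Aut_{gr}}$ (pairs are added componentwise), written additively. $K$ is a subgroup of $\mathrm{Aut_{gr}}((P\oplus C)\rtimes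 N)$, and $G=((P\oplus C)\rtimes N)\rtimes K$ has elements $(p,c,n,k)$ and multiplication $$(p',c',n',k')*(p_1,c_1,n_1,k_1)=(p'+p_1+k'_p(n_1),\ c_1+c'+k'_c(n_1)+n'(p_1+k'_p(n_1)),\ n_1+n',\ k_1+k').$$ Invariants. Fix $n\in N$, $k\in K$. Write $\operatorname{Im} n=\{n(p):p\in P\}\subset C$. Let $\Lambda:N\oplus K\to P$ be the homomorphism $\Lambda(n',k')=k_p(n')-k'_p(n)$. For $x=(p,c,n,k)$ put $R(x)=p\bmod \operatorname{Im}\Lambda\in P/\operatorname{Im}\Lambda$. For $x_i=(p_i,c_i,n,k)$ let $B_i:N\oplus K\to C/\operatorname{Im} n$ be the map $B_i(n',k')=k_c(n')-k'_c(n)-n'(p_i)\bmod \operatorname{Im} n$. Fix also a value $r\in P/\operatorname{Im}\Lambda$. For $x_i=(p_i,c_i,n,k)$ and $x_j=(p_j,c_j,n,k)$ with $R(x_i)=R(x_j)=r$ put $$V_{ij}=\{c_i-c_j-B_i(n',k') : (n',k')\in\Lambda^{-1}(p_i-p_j)\}\subset C/\operatorname{Im} n .$$ Let $V=B_i(\operatorname{Ker}\Lambda)$; this is a subgroup of $C/\operatorname{Im} n$ which depends only on $n,k,r$ (not on the choice of $x_i$ with $R(x_i)=r$), and each $V_{ij}$ is a coset of $V$. For each triple $(n,k,r)$ fix once and for all a base element $x_0=(p_0,c_0,n,k)$ with $R(x_0)=r$; for $x_1=(p_1,c_1,n,k)$ with $R(x_1)=r$, $S(x_1)\in (C/\operatorname{Im}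 n)/V$ is the class of the coset $V_{01}$. *)

theory Defs
  imports "HOL-Algebra.Algebra"
begin

text \<open>
  The abelian groups \<open>N\<close>, \<open>P\<close>, \<open>C\<close> are groups in the sense of HOL-Algebra. They are written
  multiplicatively here: sums become \<open>\<otimes>\<close>, differences \<open>x - y\<close> become \<open>x \<otimes> inv y\<close>, and direct
  sums become \<open>\<times>\<times>\<close>.
\<close>

definition semidirect ::
  "('a, 'x) monoid_scheme \<Rightarrow> ('b, 'y) monoid_scheme \<Rightarrow> ('b \<Rightarrow> 'a \<Rightarrow> 'a) \<Rightarrow> ('a \<times> 'b) monoid" where
  "semidirect A B \<phi> =
    \<lparr>carrier = carrier A \<times> carrier B,
     monoid.mult = (\<lambda>(a', b') (a, b). (a' \<otimes>\<^bsub>A\<^esub> \<phi> b' a, b' \<otimes>\<^bsub>B\<^esub> b)),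
     monoid.one = (\<one>\<^bsub>A\<^esub>, \<one>\<^bsub>B\<^esub>)\<rparr>"

definition graded_auts ::
  "('a, 'x) monoid_scheme \<Rightarrow> ('b, 'y) monoid_scheme \<Rightarrow> ('b \<Rightarrow> 'a \<Rightarrow> 'a)
    \<Rightarrow> (('a \<times> 'b) \<Rightarrow> ('a \<times> 'b)) set" where
  "graded_auts A B \<phi> =
    (let E = semidirect A B \<phi>; A' = carrier A \<times> {\<one>\<^bsub>B\<^esub>}
     in {k \<in> auto E. k ` A' = A' \<and> (\<forall>x\<in>A'. k x = x)
                     \<and> (\<forall>x\<in>carrier E. A' #>\<^bsub>E\<^esub> k x = A' #>\<^bsub>E\<^esub> x)})"

definition Aut_gr ::
  "('a, 'x) monoid_scheme \<Rightarrow> ('b, 'y) monoid_scheme \<Rightarrow> ('b \<Rightarrow> 'a \<Rightarrow> 'a)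
    \<Rightarrow> (('a \<times> 'b) \<Rightarrow> ('a \<times> 'b)) monoid" where
  "Aut_gr A B \<phi> = (AutoGroup (semidirect A B \<phi>)) \<lparr>carrier := graded_auts A B \<phi>\<rparr>"

definition conjugate_in :: "('a, 'x) monoid_scheme \<Rightarrow> 'a \<Rightarrow> 'a \<Rightarrow> bool" where
  "conjugate_in G x y \<longleftrightarrow> (\<exists>g\<in>carrier G. y = g \<otimes>\<^bsub>G\<^esub> x \<otimes>\<^bsub>G\<^esub> inv\<^bsub>G\<^esub> g)"

definition bilinear_pairing ::
  "'n monoid \<Rightarrow> 'p monoid \<Rightarrow> 'c monoid \<Rightarrow> ('n \<Rightarrow> 'p \<Rightarrow> 'c) \<Rightarrow> bool" where
  "bilinear_pairing N P C pair \<longleftrightarrow>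
    (\<forall>n\<in>carrier N. pair n \<in> hom P C) \<and> (\<forall>p\<in>carrier P. (\<lambda>n. pair n p) \<in> hom N C)"


section \<open>The extended Heisenberg group\<close>

text \<open>\<open>(p, c, n)\<close> is encoded as \<open>((p, c), n)\<close>, and \<open>(p, c, n, k)\<close> as \<open>(((p, c), n), k)\<close>.\<close>

type_synonym ('n, 'p, 'c) heis = "('p \<times> 'c) \<times> 'n"
type_synonym ('n, 'p, 'c) heis_aut = "('n, 'p, 'c) heis \<Rightarrow> ('n, 'p, 'c) heis"
type_synonym ('n, 'p, 'c) ext_heis = "('n, 'p, 'c) heis \<times> ('n, 'p, 'c) heis_aut"

definition heis_act :: "'c monoid \<Rightarrow> ('n \<Rightarrow> 'p \<Rightarrow> 'c) \<Rightarrow> 'n \<Rightarrow> 'p \<times> 'c \<Rightarrow> 'p \<times> 'c" where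
  "heis_act C pair n = (\<lambda>(p, c). (p, c \<otimes>\<^bsub>C\<^esub> pair n p))"

definition heisenberg ::
  "'n monoid \<Rightarrow> 'p monoid \<Rightarrow> 'c monoid \<Rightarrow> ('n \<Rightarrow> 'p \<Rightarrow> 'c) \<Rightarrow> ('n, 'p, 'c) heis monoid" where
  "heisenberg N P C pair = semidirect (P \<times>\<times> C) N (heis_act C pair)"

definition heis_Aut_gr ::
  "'n monoid \<Rightarrow> 'p monoid \<Rightarrow> 'c monoid \<Rightarrow> ('n \<Rightarrow> 'p \<Rightarrow> 'c) \<Rightarrow> ('n, 'p, 'c) heis_aut monoid" where
  "heis_Aut_gr N P C pair = Aut_gr (P \<times>\<times> C) N (heis_act C pair)"

definition ext_heisenberg ::
  "'n monoid \<Rightarrow> 'p monoid \<Rightarrow> 'c monoid \<Rightarrow> ('n \<Rightarrow> 'p \<Rightarrow> 'c) \<Rightarrow> ('n, 'p, 'c) heis_aut set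
    \<Rightarrow> ('n, 'p, 'c) ext_heis monoid" where
  "ext_heisenberg N P C pair K =
    semidirect (heisenberg N P C pair) ((heis_Aut_gr N P C pair)\<lparr>carrier := K\<rparr>) (\<lambda>k. k)"

text \<open>
  The components \<open>k\<^sub>p\<close> and \<open>k\<^sub>c\<close> of a graded automorphism \<open>k\<close> are read off from the element
  \<open>k (0, 0, n) = (k\<^sub>p n, k\<^sub>c n, n)\<close>; see \<open>graded_aut_apply\<close>, \<open>aut_p_mult\<close>, \<open>aut_c_mult\<close>,
  \<open>aut_mult_comp\<close> and, for the resulting multiplication in the extended Heisenberg group,
  \<open>ext_heis_mult\<close> below.
\<close>

definition aut_p :: "'p monoid \<Rightarrow> 'c monoid \<Rightarrow> ('n, 'p, 'c) heis_aut \<Rightarrow> 'n \<Rightarrow> 'p" where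
  "aut_p P C k n = fst (fst (k ((\<one>\<^bsub>P\<^esub>, \<one>\<^bsub>C\<^esub>), n)))"

definition aut_c :: "'p monoid \<Rightarrow> 'c monoid \<Rightarrow> ('n, 'p, 'c) heis_aut \<Rightarrow> 'n \<Rightarrow> 'c" where
  "aut_c P C k n = snd (fst (k ((\<one>\<^bsub>P\<^esub>, \<one>\<^bsub>C\<^esub>), n)))"


section \<open>The invariants\<close>

definition Im_n :: "'p monoid \<Rightarrow> ('n \<Rightarrow> 'p \<Rightarrow> 'c) \<Rightarrow> 'n \<Rightarrow> 'c set" where
  "Im_n P pair n = pair n ` carrier P"

definition Lam ::
  "'p monoid \<Rightarrow> 'c monoid \<Rightarrow> 'n \<Rightarrow> ('n, 'p, 'c) heis_aut \<Rightarrow> 'n \<times> ('n, 'p, 'c) heis_aut \<Rightarrow> 'p" where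
  "Lam P C n k = (\<lambda>(n', k'). aut_p P C k n' \<otimes>\<^bsub>P\<^esub> inv\<^bsub>P\<^esub> aut_p P C k' n)"

definition Im_Lam ::
  "'n monoid \<Rightarrow> 'p monoid \<Rightarrow> 'c monoid \<Rightarrow> ('n, 'p, 'c) heis_aut set
    \<Rightarrow> 'n \<Rightarrow> ('n, 'p, 'c) heis_aut \<Rightarrow> 'p set" where
  "Im_Lam N P C K n k = Lam P C n k ` (carrier N \<times> K)"

text \<open>\<open>R x\<close> is an element of \<open>P / Im \<Lambda>\<close>, i.e. a coset.\<close>

definition R_inv ::
  "'n monoid \<Rightarrow> 'p monoid \<Rightarrow> 'c monoid \<Rightarrow> ('n, 'p, 'c) heis_aut set
    \<Rightarrow> ('n, 'p, 'c) ext_heis \<Rightarrow> 'p set" where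
  "R_inv N P C K = (\<lambda>(((p, c), n), k). Im_Lam N P C K n k #>\<^bsub>P\<^esub> p)"

definition B_map ::
  "'p monoid \<Rightarrow> 'c monoid \<Rightarrow> ('n \<Rightarrow> 'p \<Rightarrow> 'c) \<Rightarrow> ('n, 'p, 'c) ext_heis
    \<Rightarrow> 'n \<times> ('n, 'p, 'c) heis_aut \<Rightarrow> 'c set" where
  "B_map P C pair = (\<lambda>(((p, c), n), k) (n', k').
    Im_n P pair n #>\<^bsub>C\<^esub>
      (aut_c P C k n' \<otimes>\<^bsub>C\<^esub> inv\<^bsub>C\<^esub> aut_c P C k' n \<otimes>\<^bsub>C\<^esub> inv\<^bsub>C\<^esub> pair n' p))"

text \<open>
  For \<open>x\<^sub>i\<close>, \<open>x\<^sub>j\<close> with the same \<open>n\<close> and \<open>k\<close> (those of \<open>x\<^sub>j\<close> are ignored), \<open>V_set \<dots> x\<^sub>i x\<^sub>j\<close> is \<open>V\<^sub>i\<^sub>j\<close>,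
  and \<open>V_sub \<dots> x\<^sub>i\<close> is \<open>V = B\<^sub>i (Ker \<Lambda>)\<close>.
\<close>

definition V_set ::
  "'n monoid \<Rightarrow> 'p monoid \<Rightarrow> 'c monoid \<Rightarrow> ('n \<Rightarrow> 'p \<Rightarrow> 'c) \<Rightarrow> ('n, 'p, 'c) heis_aut set
    \<Rightarrow> ('n, 'p, 'c) ext_heis \<Rightarrow> ('n, 'p, 'c) ext_heis \<Rightarrow> 'c set set" where
  "V_set N P C pair K = (\<lambda>(((p\<^sub>i, c\<^sub>i), n), k) (((p\<^sub>j, c\<^sub>j), _), _).
    let Q = C Mod Im_n P pair n
    in {(Im_n P pair n #>\<^bsub>C\<^esub> (c\<^sub>i \<otimes>\<^bsub>C\<^esub> inv\<^bsub>C\<^esub> c\<^sub>j)) \<otimes>\<^bsub>Q\<^esub> inv\<^bsub>Q\<^esub> B_map P C pair (((p\<^sub>i, c\<^sub>i), n), k) (n', k') | n' k'.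
         n' \<in> carrier N \<and> k' \<in> K \<and> Lam P C n k (n', k') = p\<^sub>i \<otimes>\<^bsub>P\<^esub> inv\<^bsub>P\<^esub> p\<^sub>j})"

definition V_sub ::
  "'n monoid \<Rightarrow> 'p monoid \<Rightarrow> 'c monoid \<Rightarrow> ('n \<Rightarrow> 'p \<Rightarrow> 'c) \<Rightarrow> ('n, 'p, 'c) heis_aut set
    \<Rightarrow> ('n, 'p, 'c) ext_heis \<Rightarrow> 'c set set" where
  "V_sub N P C pair K = (\<lambda>(((p, c), n), k).
    B_map P C pair (((p, c), n), k) `
      kernel (N \<times>\<times> (heis_Aut_gr N P C pair)\<lparr>carrier := K\<rparr>) P (Lam P C n k))"

text \<open>A choice of base elements \<open>x\<^sub>0\<close>, one for each triple \<open>(n, k, r)\<close>.\<close>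

definition base_choice ::
  "'n monoid \<Rightarrow> 'p monoid \<Rightarrow> 'c monoid \<Rightarrow> ('n \<Rightarrow> 'p \<Rightarrow> 'c) \<Rightarrow> ('n, 'p, 'c) heis_aut set
    \<Rightarrow> ('n \<Rightarrow> ('n, 'p, 'c) heis_aut \<Rightarrow> 'p set \<Rightarrow> ('n, 'p, 'c) ext_heis) \<Rightarrow> bool" where
  "base_choice N P C pair K x\<^sub>0 \<longleftrightarrow>
    (\<forall>n\<in>carrier N. \<forall>k\<in>K. \<forall>r\<in>carrier (P Mod Im_Lam N P C K n k).
      \<exists>p\<^sub>0\<in>carrier P. \<exists>c\<^sub>0\<in>carrier C.
        x\<^sub>0 n k r = (((p\<^sub>0, c\<^sub>0), n), k) \<and> R_inv N P C K (x\<^sub>0 n k r) = r)"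

text \<open>
  The elements of \<open>(C / Im n) / V\<close> are the cosets of \<open>V\<close> in \<open>C / Im n\<close>, so the class of the coset
  \<open>V\<^sub>0\<^sub>1\<close> is this coset itself; see \<open>V_sub_subgroup\<close> and \<open>V_set_in_quotient\<close>.
\<close>

definition S_inv ::
  "'n monoid \<Rightarrow> 'p monoid \<Rightarrow> 'c monoid \<Rightarrow> ('n \<Rightarrow> 'p \<Rightarrow> 'c) \<Rightarrow> ('n, 'p, 'c) heis_aut set
    \<Rightarrow> ('n \<Rightarrow> ('n, 'p, 'c) heis_aut \<Rightarrow> 'p set \<Rightarrow> ('n, 'p, 'c) ext_heis)
    \<Rightarrow> ('n, 'p, 'c) ext_heis \<Rightarrow> 'c set set" where
  "S_inv N P C pair K x\<^sub>0 x = (case x of (((p, c), n), k) \<Rightarrow>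
    V_set N P C pair K (x\<^sub>0 n k (R_inv N P C K x)) x)"


section \<open>Consistency of the definitions\<close>

locale heis_data = N: comm_group N + P: comm_group P + C: comm_group C
  for N :: "'n monoid" and P :: "'p monoid" and C :: "'c monoid" +
  fixes pair :: "'n \<Rightarrow> 'p \<Rightarrow> 'c"
  assumes bilin: "bilinear_pairing N P C pair"
begin

lemma pair_closed [simp]: "n \<in> carrier N \<Longrightarrow> p \<in> carrier P \<Longrightarrow> pair n p \<in> carrier C"
  using bilin by (auto simp: bilinear_pairing_def hom_def)

lemma pair_mult_right:
  "n \<in> carrier N \<Longrightarrow> p \<in> carrier P \<Longrightarrow> q \<in> carrier P \<Longrightarrow>
    pair n (p \<otimes>\<^bsub>P\<^esub> q) = pair n p \<otimes>\<^bsub>C\<^esub> pair n q"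
  using bilin by (auto simp: bilinear_pairing_def hom_def)

lemma pair_mult_left:
  "n \<in> carrier N \<Longrightarrow> m \<in> carrier N \<Longrightarrow> p \<in> carrier P \<Longrightarrow>
    pair (n \<otimes>\<^bsub>N\<^esub> m) p = pair n p \<otimes>\<^bsub>C\<^esub> pair m p"
  using bilin by (auto simp: bilinear_pairing_def hom_def)

lemma pair_hom_right: "n \<in> carrier N \<Longrightarrow> group_hom P C (pair n)"
  using bilin by unfold_locales (auto simp: bilinear_pairing_def)

lemma pair_hom_left: "p \<in> carrier P \<Longrightarrow> group_hom N C (\<lambda>n. pair n p)"
  using bilin by unfold_locales (auto simp: bilinear_pairing_def)

lemma pair_one_right [simp]: "n \<in> carrier N \<Longrightarrow> pair n \<one>\<^bsub>P\<^esub> = \<one>\<^bsub>C\<^esub>"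
  using group_hom.hom_one[OF pair_hom_right] .

lemma pair_one_left [simp]: "p \<in> carrier P \<Longrightarrow> pair \<one>\<^bsub>N\<^esub> p = \<one>\<^bsub>C\<^esub>"
  using group_hom.hom_one[OF pair_hom_left] .

lemma pair_inv_right [simp]:
  "n \<in> carrier N \<Longrightarrow> p \<in> carrier P \<Longrightarrow> pair n (inv\<^bsub>P\<^esub> p) = inv\<^bsub>C\<^esub> pair n p"
  by (rule group_hom.hom_inv[OF pair_hom_right])

lemma heis_carrier: "carrier (heisenberg N P C pair) = (carrier P \<times> carrier C) \<times> carrier N"
  by (simp add: heisenberg_def semidirect_def)

lemma heis_mult:
  "((p', c'), n') \<otimes>\<^bsub>heisenberg N P C pair\<^esub> ((p, c), n) =
    ((p' \<otimes>\<^bsub>P\<^esub> p, c' \<otimes>\<^bsub>C\<^esub> (c \<otimes>\<^bsub>C\<^esub> pair n' p)), n' \<otimes>\<^bsub>N\<^esub> n)"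
  by (simp add: heisenberg_def semidirect_def heis_act_def)

lemma heis_one: "\<one>\<^bsub>heisenberg N P C pair\<^esub> = ((\<one>\<^bsub>P\<^esub>, \<one>\<^bsub>C\<^esub>), \<one>\<^bsub>N\<^esub>)"
  by (simp add: heisenberg_def semidirect_def)

lemma graded_aut_apply:
  assumes k: "k \<in> carrier (heis_Aut_gr N P C pair)"
    and x: "p \<in> carrier P" "c \<in> carrier C" "n \<in> carrier N"
  shows "k ((p, c), n) = ((p \<otimes>\<^bsub>P\<^esub> aut_p P C k n, c \<otimes>\<^bsub>C\<^esub> aut_c P C k n), n)"
    and "aut_p P C k n \<in> carrier P" and "aut_c P C k n \<in> carrier C"
proof -
  let ?H = "heisenberg N P C pair"
  let ?A = "(carrier P \<times> carrier C) \<times> {\<one>\<^bsub>N\<^esub>}"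
  let ?z = "((\<one>\<^bsub>P\<^esub>, \<one>\<^bsub>C\<^esub>), n)"
  from k have aut: "k \<in> auto ?H" and triv: "\<forall>x\<in>?A. k x = x"
    and quot: "\<forall>x\<in>carrier ?H. ?A #>\<^bsub>?H\<^esub> k x = ?A #>\<^bsub>?H\<^esub> x"
    by (auto simp: heis_Aut_gr_def Aut_gr_def graded_auts_def heisenberg_def Let_def)
  have zc: "?z \<in> carrier ?H" using x by (simp add: heis_carrier)
  have kz: "k ?z \<in> carrier ?H"
    using aut zc by (auto simp: auto_def hom_def)
  then obtain q d m where q: "k ?z = ((q, d), m)" "q \<in> carrier P" "d \<in> carrier C" "m \<in> carrier N"
    by (cases "k ?z") (auto simp: heis_carrier)
  have e: "aut_p P C k n = q" "aut_c P C k n = d"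
    using q by (simp_all add: aut_p_def aut_c_def)
  have "?z \<in> ?A #>\<^bsub>?H\<^esub> ?z"
    using x by (auto simp: r_coset_def heis_mult intro!: bexI[of _ "((\<one>\<^bsub>P\<^esub>, \<one>\<^bsub>C\<^esub>), \<one>\<^bsub>N\<^esub>)"])
  then have "?z \<in> ?A #>\<^bsub>?H\<^esub> k ?z" using quot zc by blast
  then have "m = n" using q by (auto simp: r_coset_def heis_mult)
  then have kz': "k ?z = ((q, d), n)" using q by simp
  have "((p, c), n) = ((p, c), \<one>\<^bsub>N\<^esub>) \<otimes>\<^bsub>?H\<^esub> ?z"
    using x by (simp add: heis_mult)
  then have "k ((p, c), n) = k ((p, c), \<one>\<^bsub>N\<^esub>) \<otimes>\<^bsub>?H\<^esub> k ?z"
    using aut x zc by (simp add: auto_def hom_def heis_carrier)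
  also have "k ((p, c), \<one>\<^bsub>N\<^esub>) = ((p, c), \<one>\<^bsub>N\<^esub>)" using triv x by simp
  finally show "k ((p, c), n) = ((p \<otimes>\<^bsub>P\<^esub> aut_p P C k n, c \<otimes>\<^bsub>C\<^esub> aut_c P C k n), n)"
    unfolding kz' e using x q by (simp add: heis_mult)
  show "aut_p P C k n \<in> carrier P" "aut_c P C k n \<in> carrier C" using e q by simp_all
qed

lemma ext_heis_mult:
  assumes "k' \<in> carrier (heis_Aut_gr N P C pair)"
    and "p \<in> carrier P" "c \<in> carrier C" "n \<in> carrier N"
  shows "(((p', c'), n'), k') \<otimes>\<^bsub>ext_heisenberg N P C pair K\<^esub> (((p, c), n), k) =
    (((p' \<otimes>\<^bsub>P\<^esub> (p \<otimes>\<^bsub>P\<^esub> aut_p P C k' n),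
       c' \<otimes>\<^bsub>C\<^esub> (c \<otimes>\<^bsub>C\<^esub> aut_c P C k' n \<otimes>\<^bsub>C\<^esub> pair n' (p \<otimes>\<^bsub>P\<^esub> aut_p P C k' n))),
      n' \<otimes>\<^bsub>N\<^esub> n), k' \<otimes>\<^bsub>heis_Aut_gr N P C pair\<^esub> k)"
  using assms by (simp add: ext_heisenberg_def semidirect_def heis_mult graded_aut_apply)

lemma aut_mult:
  assumes k: "k \<in> carrier (heis_Aut_gr N P C pair)"
    and n: "n \<in> carrier N" "m \<in> carrier N"
  shows aut_p_mult: "aut_p P C k (n \<otimes>\<^bsub>N\<^esub> m) = aut_p P C k n \<otimes>\<^bsub>P\<^esub> aut_p P C k m"
    and aut_c_mult: "aut_c P C k (n \<otimes>\<^bsub>N\<^esub> m) =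
      aut_c P C k n \<otimes>\<^bsub>C\<^esub> aut_c P C k m \<otimes>\<^bsub>C\<^esub> pair n (aut_p P C k m)"
proof -
  let ?H = "heisenberg N P C pair"
  let ?z = "\<lambda>n. ((\<one>\<^bsub>P\<^esub>, \<one>\<^bsub>C\<^esub>), n)"
  from k have aut: "k \<in> auto ?H"
    by (auto simp: heis_Aut_gr_def Aut_gr_def graded_auts_def heisenberg_def Let_def)
  have "k (?z n \<otimes>\<^bsub>?H\<^esub> ?z m) = k (?z n) \<otimes>\<^bsub>?H\<^esub> k (?z m)"
    using aut n by (simp add: auto_def hom_def heis_carrier)
  then have eq: "k (?z (n \<otimes>\<^bsub>N\<^esub> m)) = k (?z n) \<otimes>\<^bsub>?H\<^esub> k (?z m)"
    using n by (simp add: heis_mult)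
  note closed = graded_aut_apply(2,3)[OF k P.one_closed C.one_closed]
  note app = graded_aut_apply(1)[OF k P.one_closed C.one_closed]
  from eq have *: "aut_p P C k (n \<otimes>\<^bsub>N\<^esub> m) = aut_p P C k n \<otimes>\<^bsub>P\<^esub> aut_p P C k m \<and>
      aut_c P C k (n \<otimes>\<^bsub>N\<^esub> m) =
      aut_c P C k n \<otimes>\<^bsub>C\<^esub> (aut_c P C k m \<otimes>\<^bsub>C\<^esub> pair n (aut_p P C k m))"
    using n by (simp add: heis_mult app closed)
  then show "aut_p P C k (n \<otimes>\<^bsub>N\<^esub> m) = aut_p P C k n \<otimes>\<^bsub>P\<^esub> aut_p P C k m"
    and "aut_c P C k (n \<otimes>\<^bsub>N\<^esub> m) =
      aut_c P C k n \<otimes>\<^bsub>C\<^esub> aut_c P C k m \<otimes>\<^bsub>C\<^esub> pair n (aut_p P C k m)"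
    using n by (simp_all add: C.m_assoc closed)
qed


lemma group_heisenberg: "group (heisenberg N P C pair)"
proof (rule groupI)
  fix x assume "x \<in> carrier (heisenberg N P C pair)"
  then obtain p c n where x: "x = ((p, c), n)" "p \<in> carrier P" "c \<in> carrier C" "n \<in> carrier N"
    by (auto simp: heis_carrier)
  let ?y = "((inv\<^bsub>P\<^esub> p, inv\<^bsub>C\<^esub> (c \<otimes>\<^bsub>C\<^esub> pair (inv\<^bsub>N\<^esub> n) p)), inv\<^bsub>N\<^esub> n)"
  show "\<exists>y\<in>carrier (heisenberg N P C pair). y \<otimes>\<^bsub>heisenberg N P C pair\<^esub> x = \<one>\<^bsub>heisenberg N P C pair\<^esub>"
    using x by (intro bexI[of _ ?y])
      (simp_all add: heis_carrier heis_mult heis_one)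
qed (auto simp: heis_carrier heis_mult heis_one P.m_assoc C.m_assoc N.m_assoc
       pair_mult_right pair_mult_left C.m_lcomm C.m_comm)

lemma group_Aut_gr: "group (heis_Aut_gr N P C pair)"
proof -
  let ?H = "heisenberg N P C pair"
  let ?A = "(carrier P \<times> carrier C) \<times> {\<one>\<^bsub>N\<^esub>}"
  let ?S = "graded_auts (P \<times>\<times> C) N (heis_act C pair)"
  interpret H: group ?H by (rule group_heisenberg)
  interpret AG: group "AutoGroup ?H" by (rule H.AutoGroup)
  have S: "k \<in> ?S \<longleftrightarrow> k \<in> auto ?H \<and> (\<forall>x\<in>?A. k x = x)
      \<and> (\<forall>x\<in>carrier ?H. ?A #>\<^bsub>?H\<^esub> k x = ?A #>\<^bsub>?H\<^esub> x)" for k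
    by (auto simp: graded_auts_def heisenberg_def Let_def image_iff)
  have sub: "x \<in> ?A \<Longrightarrow> x \<in> carrier ?H" for x by (auto simp: heis_carrier)
  have car: "carrier (AutoGroup ?H) = auto ?H" by (simp add: AutoGroup_def)
  have mul: "(k \<otimes>\<^bsub>AutoGroup ?H\<^esub> j) x = k (j x)"
    if "k \<in> auto ?H" "j \<in> auto ?H" "x \<in> carrier ?H" for k j x
    using that by (auto simp: AutoGroup_def BijGroup_def auto_def compose_def)
  have one: "\<one>\<^bsub>AutoGroup ?H\<^esub> x = x" if "x \<in> carrier ?H" for x
    using that by (simp add: AutoGroup_def BijGroup_def)
  have cl: "k x \<in> carrier ?H" if "k \<in> auto ?H" "x \<in> carrier ?H" for k x
    using that by (auto simp: auto_def hom_def)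
  have "subgroup ?S (AutoGroup ?H)"
  proof (rule AG.subgroupI)
    show "?S \<subseteq> carrier (AutoGroup ?H)" using S car by blast
    have "\<one>\<^bsub>AutoGroup ?H\<^esub> \<in> ?S"
      unfolding S using AG.one_closed one sub car by auto
    then show "?S \<noteq> {}" by blast
  next
    fix k assume k: "k \<in> ?S"
    let ?j = "inv\<^bsub>AutoGroup ?H\<^esub> k"
    have ka: "k \<in> auto ?H" and ja: "?j \<in> auto ?H"
      using k S car AG.inv_closed by auto
    have jk: "?j (k x) = x" and kj: "k (?j x) = x" if "x \<in> carrier ?H" for x
      using mul[OF ja ka that] mul[OF ka ja that] one[OF that] AG.l_inv AG.r_inv ka car by auto
    show "?j \<in> ?S"
      unfolding S
    proof (intro conjI ballI)
      fix x assume "x \<in> ?A"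
      then show "?j x = x" using jk[OF sub] k S by metis
    next
      fix x assume "x \<in> carrier ?H"
      then show "?A #>\<^bsub>?H\<^esub> ?j x = ?A #>\<^bsub>?H\<^esub> x"
        using kj cl[OF ja] k S by metis
    qed (rule ja)
  next
    fix k j assume k: "k \<in> ?S" and j: "j \<in> ?S"
    then have ka: "k \<in> auto ?H" and ja: "j \<in> auto ?H" using S by auto
    show "k \<otimes>\<^bsub>AutoGroup ?H\<^esub> j \<in> ?S"
      unfolding S
    proof (intro conjI ballI)
      show "k \<otimes>\<^bsub>AutoGroup ?H\<^esub> j \<in> auto ?H" using AG.m_closed ka ja car by auto
    next
      fix x assume "x \<in> ?A"
      then show "(k \<otimes>\<^bsub>AutoGroup ?H\<^esub> j) x = x" using mul[OF ka ja sub] k j S by metis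
    next
      fix x assume "x \<in> carrier ?H"
      then show "?A #>\<^bsub>?H\<^esub> (k \<otimes>\<^bsub>AutoGroup ?H\<^esub> j) x = ?A #>\<^bsub>?H\<^esub> x"
        using mul[OF ka ja] cl[OF ja] k j S by metis
    qed
  qed
  then have "group ((AutoGroup ?H)\<lparr>carrier := ?S\<rparr>)"
    by (rule AG.subgroup_imp_group)
  then show ?thesis by (simp add: heis_Aut_gr_def Aut_gr_def heisenberg_def)
qed

lemma aut_mult_comp:
  assumes k: "k \<in> carrier (heis_Aut_gr N P C pair)" and j: "j \<in> carrier (heis_Aut_gr N P C pair)"
    and n: "n \<in> carrier N"
  shows "aut_p P C (k \<otimes>\<^bsub>heis_Aut_gr N P C pair\<^esub> j) n = aut_p P C k n \<otimes>\<^bsub>P\<^esub> aut_p P C j n"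
    and "aut_c P C (k \<otimes>\<^bsub>heis_Aut_gr N P C pair\<^esub> j) n = aut_c P C k n \<otimes>\<^bsub>C\<^esub> aut_c P C j n"
proof -
  let ?z = "((\<one>\<^bsub>P\<^esub>, \<one>\<^bsub>C\<^esub>), n)"
  have "(k \<otimes>\<^bsub>heis_Aut_gr N P C pair\<^esub> j) ?z = k (j ?z)"
    using k j n by (auto simp: heis_Aut_gr_def Aut_gr_def graded_auts_def Let_def AutoGroup_def
        BijGroup_def auto_def compose_def heis_carrier[unfolded heisenberg_def])
  then have *: "(k \<otimes>\<^bsub>heis_Aut_gr N P C pair\<^esub> j) ?z =
      ((aut_p P C j n \<otimes>\<^bsub>P\<^esub> aut_p P C k n, aut_c P C j n \<otimes>\<^bsub>C\<^esub> aut_c P C k n), n)"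
    using n graded_aut_apply(2,3)[OF j P.one_closed C.one_closed n]
    by (simp add: graded_aut_apply(1)[OF j] graded_aut_apply(1)[OF k])
  show "aut_p P C (k \<otimes>\<^bsub>heis_Aut_gr N P C pair\<^esub> j) n = aut_p P C k n \<otimes>\<^bsub>P\<^esub> aut_p P C j n"
    and "aut_c P C (k \<otimes>\<^bsub>heis_Aut_gr N P C pair\<^esub> j) n = aut_c P C k n \<otimes>\<^bsub>C\<^esub> aut_c P C j n"
    unfolding aut_p_def[of P C "k \<otimes>\<^bsub>heis_Aut_gr N P C pair\<^esub> j"]
      aut_c_def[of P C "k \<otimes>\<^bsub>heis_Aut_gr N P C pair\<^esub> j"] *
    using graded_aut_apply(2,3)[OF j P.one_closed C.one_closed n]
      graded_aut_apply(2,3)[OF k P.one_closed C.one_closed n]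
    by (simp_all add: P.m_comm C.m_comm)
qed

lemma pair_aut_sym:
  assumes k: "k \<in> carrier (heis_Aut_gr N P C pair)" and n: "n \<in> carrier N" "m \<in> carrier N"
  shows "pair n (aut_p P C k m) = pair m (aut_p P C k n)"
proof -
  note closed = graded_aut_apply(2,3)[OF k P.one_closed C.one_closed]
  have "aut_c P C k (n \<otimes>\<^bsub>N\<^esub> m) = aut_c P C k (m \<otimes>\<^bsub>N\<^esub> n)" using n by (simp add: N.m_comm)
  then show ?thesis
    using n closed by (simp add: aut_c_mult[OF k] C.m_comm[of "aut_c P C k n"])
qed

end


locale ext_heis_data = heis_data N P C pair
  for N :: "'n monoid" and P :: "'p monoid" and C :: "'c monoid" and pair :: "'n \<Rightarrow> 'p \<Rightarrow> 'c" +
  fixes K :: "('n, 'p, 'c) heis_aut set" and n :: 'n and k :: "('n, 'p, 'c) heis_aut"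
  assumes K: "subgroup K (heis_Aut_gr N P C pair)"
    and n: "n \<in> carrier N" and k: "k \<in> K"
begin

abbreviation KG where "KG \<equiv> (heis_Aut_gr N P C pair)\<lparr>carrier := K\<rparr>"
abbreviation NK where "NK \<equiv> N \<times>\<times> KG"
abbreviation Q where "Q \<equiv> C Mod Im_n P pair n"

lemma K_gr: "j \<in> K \<Longrightarrow> j \<in> carrier (heis_Aut_gr N P C pair)"
  using subgroup.subset[OF K] by blast

lemmas kp_closed [simp] = graded_aut_apply(2)[OF K_gr P.one_closed C.one_closed]
lemmas kc_closed [simp] = graded_aut_apply(3)[OF K_gr P.one_closed C.one_closed]

lemma group_KG: "group KG"
  using group.subgroup_imp_group[OF group_Aut_gr K] .

lemma group_NK: "group NK"
  using DirProd_group[OF N.is_group group_KG] .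

lemma Lam_hom: "group_hom NK P (Lam P C n k)"
proof (intro group_hom.intro group_NK P.is_group group_hom_axioms.intro homI)
  fix x assume "x \<in> carrier NK"
  then show "Lam P C n k x \<in> carrier P" using n k by (auto simp: Lam_def)
next
  fix x y assume "x \<in> carrier NK" "y \<in> carrier NK"
  then show "Lam P C n k (x \<otimes>\<^bsub>NK\<^esub> y) = Lam P C n k x \<otimes>\<^bsub>P\<^esub> Lam P C n k y"
    using n k
    by (auto simp: Lam_def aut_p_mult[OF K_gr] aut_mult_comp[OF K_gr K_gr] P.inv_mult P.m_ac)
qed

lemma Im_n_subgroup: "subgroup (Im_n P pair n) C"
  unfolding Im_n_def by (rule group_hom.img_is_subgroup[OF pair_hom_right[OF n]])

lemma Im_n_normal: "Im_n P pair n \<lhd> C"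
  by (rule C.subgroup_imp_normal[OF Im_n_subgroup])

lemma Im_Lam_subgroup: "subgroup (Im_Lam N P C K n k) P"
  using group_hom.img_is_subgroup[OF Lam_hom] by (simp add: Im_Lam_def)

lemma coset_hom: "group_hom C Q (\<lambda>c. Im_n P pair n #>\<^bsub>C\<^esub> c)"
  by (intro group_hom.intro group_hom_axioms.intro C.is_group normal.factorgroup_is_group
      normal.r_coset_hom_Mod Im_n_normal)

definition beta :: "'p \<Rightarrow> 'n \<times> ('n, 'p, 'c) heis_aut \<Rightarrow> 'c" where
  "beta p = (\<lambda>(n', k').
    aut_c P C k n' \<otimes>\<^bsub>C\<^esub> inv\<^bsub>C\<^esub> aut_c P C k' n \<otimes>\<^bsub>C\<^esub> inv\<^bsub>C\<^esub> pair n' p)"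

lemma B_map_beta: "B_map P C pair (((p, c), n), k) a = Im_n P pair n #>\<^bsub>C\<^esub> beta p a"
  by (cases a) (simp add: B_map_def beta_def)

lemma beta_closed [simp]: "p \<in> carrier P \<Longrightarrow> a \<in> carrier NK \<Longrightarrow> beta p a \<in> carrier C"
  using n k by (auto simp: beta_def)

lemma beta_mult:
  assumes "p \<in> carrier P" "a \<in> carrier NK" "b \<in> carrier NK"
  shows "beta p (a \<otimes>\<^bsub>NK\<^esub> b) = pair (fst a) (aut_p P C k (fst b)) \<otimes>\<^bsub>C\<^esub> (beta p a \<otimes>\<^bsub>C\<^esub> beta p b)"
  using assms n k
  by (cases a; cases b)
    (simp add: beta_def aut_c_mult[OF K_gr] aut_mult_comp[OF K_gr K_gr] pair_mult_left
      C.inv_mult C.m_ac)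

lemma B_map_mult_ker:
  assumes p: "p \<in> carrier P" and a: "a \<in> carrier NK" and b: "b \<in> kernel NK P (Lam P C n k)"
  shows "B_map P C pair (((p, c), n), k) (a \<otimes>\<^bsub>NK\<^esub> b) =
    B_map P C pair (((p, c), n), k) a \<otimes>\<^bsub>Q\<^esub> B_map P C pair (((p, c), n), k) b"
proof -
  obtain m j a' where b': "b = (m, j)" "m \<in> carrier N" "j \<in> K" "a' = fst a" "a' \<in> carrier N"
    using a b by (auto simp: kernel_def)
  have bK: "b \<in> carrier NK" using b by (simp add: kernel_def)
  have "aut_p P C k m \<otimes>\<^bsub>P\<^esub> inv\<^bsub>P\<^esub> aut_p P C j n = \<one>\<^bsub>P\<^esub>"
    using b b' by (simp add: kernel_def Lam_def)
  then have e: "aut_p P C k m = aut_p P C j n"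
    using b' n k by (metis P.inv_equality P.inv_inv P.inv_closed kp_closed)
  have "pair a' (aut_p P C k m) = pair n (aut_p P C j a')"
    unfolding e using b' n by (intro pair_aut_sym K_gr)
  then have i: "pair (fst a) (aut_p P C k (fst b)) \<in> Im_n P pair n"
    using b' by (auto simp: Im_n_def)
  interpret h: group_hom C Q "\<lambda>c. Im_n P pair n #>\<^bsub>C\<^esub> c" by (rule coset_hom)
  have ic: "pair (fst a) (aut_p P C k (fst b)) \<in> carrier C"
    using i subgroup.subset[OF Im_n_subgroup] by blast
  have "Im_n P pair n #>\<^bsub>C\<^esub> pair (fst a) (aut_p P C k (fst b)) = \<one>\<^bsub>Q\<^esub>"
    using C.coset_join2[OF ic Im_n_subgroup i] by simp
  then show ?thesis
    unfolding B_map_beta beta_mult[OF p a bK]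
    using p a bK ic by (simp del: one_FactGroup mult_FactGroup carrier_DirProd)
qed

lemma comm_group_Q: "comm_group Q"
  using C.abelian_FactGroup[OF Im_n_subgroup] .

lemma V_sub_subgroup:
  assumes p: "p \<in> carrier P"
  shows "subgroup (V_sub N P C pair K (((p, c), n), k)) Q"
proof -
  let ?k = "kernel NK P (Lam P C n k)" and ?B = "B_map P C pair (((p, c), n), k)"
  interpret h: group_hom C Q "\<lambda>c. Im_n P pair n #>\<^bsub>C\<^esub> c" by (rule coset_hom)
  have "group (NK\<lparr>carrier := ?k\<rparr>)"
    using group.subgroup_imp_group[OF group_NK group_hom.subgroup_kernel[OF Lam_hom]] .
  moreover have "?B \<in> hom (NK\<lparr>carrier := ?k\<rparr>) Q"
  proof (rule homI)
    fix x assume "x \<in> carrier (NK\<lparr>carrier := ?k\<rparr>)"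
    then show "?B x \<in> carrier Q" unfolding B_map_beta
      using p by (intro h.hom_closed beta_closed) (auto simp: kernel_def)
  next
    fix x y assume "x \<in> carrier (NK\<lparr>carrier := ?k\<rparr>)" "y \<in> carrier (NK\<lparr>carrier := ?k\<rparr>)"
    then have "x \<in> carrier NK" "y \<in> ?k" by (auto simp: kernel_def)
    then show "?B (x \<otimes>\<^bsub>NK\<lparr>carrier := ?k\<rparr>\<^esub> y) = ?B x \<otimes>\<^bsub>Q\<^esub> ?B y"
      using B_map_mult_ker[OF p] by simp
  qed
  ultimately have "group_hom (NK\<lparr>carrier := ?k\<rparr>) Q ?B"
    by (intro group_hom.intro group_hom_axioms.intro h.H.is_group)
  from group_hom.img_is_subgroup[OF this] show ?thesis by (simp add: V_sub_def)
qed

lemma V_set_in_quotient: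
  assumes p: "p\<^sub>i \<in> carrier P" "p\<^sub>j \<in> carrier P" and c: "c\<^sub>i \<in> carrier C" "c\<^sub>j \<in> carrier C"
    and R: "R_inv N P C K (((p\<^sub>i, c\<^sub>i), n), k) = R_inv N P C K (((p\<^sub>j, c\<^sub>j), n), k)"
  shows "V_set N P C pair K (((p\<^sub>i, c\<^sub>i), n), k) (((p\<^sub>j, c\<^sub>j), n), k)
    \<in> carrier ((C Mod Im_n P pair n) Mod V_sub N P C pair K (((p\<^sub>i, c\<^sub>i), n), k))"
proof -
  let ?k = "kernel NK P (Lam P C n k)" and ?B = "B_map P C pair (((p\<^sub>i, c\<^sub>i), n), k)"
  let ?V = "V_sub N P C pair K (((p\<^sub>i, c\<^sub>i), n), k)"
  let ?d = "Im_n P pair n #>\<^bsub>C\<^esub> (c\<^sub>i \<otimes>\<^bsub>C\<^esub> inv\<^bsub>C\<^esub> c\<^sub>j)"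
  interpret Q: comm_group Q by (rule comm_group_Q)
  interpret h: group_hom C Q "\<lambda>c. Im_n P pair n #>\<^bsub>C\<^esub> c" by (rule coset_hom)
  interpret L: group_hom NK P "Lam P C n k" by (rule Lam_hom)
  interpret V: subgroup ?V Q by (rule V_sub_subgroup[OF p(1)])
  have d: "?d \<in> carrier Q" using c by (intro h.hom_closed) auto
  have B: "?B a \<in> carrier Q" if "a \<in> carrier NK" for a
    unfolding B_map_beta using p that by (intro h.hom_closed beta_closed)
  have V: "?V = ?B ` ?k" by (simp add: V_sub_def)
  have "p\<^sub>i \<in> Im_Lam N P C K n k #>\<^bsub>P\<^esub> p\<^sub>j"
    using P.rcos_self[OF p(1) Im_Lam_subgroup] R by (simp add: R_inv_def)
  then obtain a where a: "a \<in> carrier NK" "p\<^sub>i = Lam P C n k a \<otimes>\<^bsub>P\<^esub> p\<^sub>j"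
    by (auto simp: r_coset_def Im_Lam_def)
  then have La: "Lam P C n k a = p\<^sub>i \<otimes>\<^bsub>P\<^esub> inv\<^bsub>P\<^esub> p\<^sub>j"
    using p L.hom_closed[OF a(1)] by (simp add: P.m_assoc)
  have lev: "a' \<in> carrier NK \<and> Lam P C n k a' = p\<^sub>i \<otimes>\<^bsub>P\<^esub> inv\<^bsub>P\<^esub> p\<^sub>j \<longleftrightarrow> (\<exists>b\<in>?k. a' = a \<otimes>\<^bsub>NK\<^esub> b)"
    for a'
  proof
    assume a': "a' \<in> carrier NK \<and> Lam P C n k a' = p\<^sub>i \<otimes>\<^bsub>P\<^esub> inv\<^bsub>P\<^esub> p\<^sub>j"
    let ?b = "inv\<^bsub>NK\<^esub> a \<otimes>\<^bsub>NK\<^esub> a'"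
    have bc: "?b \<in> carrier NK"
      by (rule L.G.m_closed[OF L.G.inv_closed[OF a(1)] conjunct1[OF a']])
    have "Lam P C n k ?b = inv\<^bsub>P\<^esub> Lam P C n k a \<otimes>\<^bsub>P\<^esub> Lam P C n k a'"
      using a a' L.hom_mult L.hom_inv L.G.inv_closed by metis
    then have "?b \<in> ?k" using bc a' La p by (simp add: kernel_def)
    moreover have "a' = a \<otimes>\<^bsub>NK\<^esub> ?b"
      using a a' L.G.m_assoc L.G.r_inv L.G.l_one L.G.inv_closed by metis
    ultimately show "\<exists>b\<in>?k. a' = a \<otimes>\<^bsub>NK\<^esub> b" by blast
  next
    assume "\<exists>b\<in>?k. a' = a \<otimes>\<^bsub>NK\<^esub> b"
    then obtain b where b: "b \<in> carrier NK" "Lam P C n k b = \<one>\<^bsub>P\<^esub>" "a' = a \<otimes>\<^bsub>NK\<^esub> b"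
      by (auto simp: kernel_def)
    then show "a' \<in> carrier NK \<and> Lam P C n k a' = p\<^sub>i \<otimes>\<^bsub>P\<^esub> inv\<^bsub>P\<^esub> p\<^sub>j"
      using a La L.hom_mult[OF a(1) b(1)] L.G.m_closed[OF a(1) b(1)] L.hom_closed[OF a(1)] p by simp
  qed
  have "V_set N P C pair K (((p\<^sub>i, c\<^sub>i), n), k) (((p\<^sub>j, c\<^sub>j), n), k) =
      {?d \<otimes>\<^bsub>Q\<^esub> inv\<^bsub>Q\<^esub> ?B a' | a'. a' \<in> carrier NK \<and> Lam P C n k a' = p\<^sub>i \<otimes>\<^bsub>P\<^esub> inv\<^bsub>P\<^esub> p\<^sub>j}"
    by (auto simp: V_set_def Let_def)
  also have "\<dots> = {?d \<otimes>\<^bsub>Q\<^esub> inv\<^bsub>Q\<^esub> ?B (a \<otimes>\<^bsub>NK\<^esub> b) | b. b \<in> ?k}"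
    unfolding lev by blast
  also have "\<dots> = {?d \<otimes>\<^bsub>Q\<^esub> inv\<^bsub>Q\<^esub> (?B a \<otimes>\<^bsub>Q\<^esub> v) | v. v \<in> ?V}"
    unfolding V using B_map_mult_ker[OF p(1) a(1)] by (auto simp del: mult_FactGroup) metis
  also have "\<dots> = {inv\<^bsub>Q\<^esub> v \<otimes>\<^bsub>Q\<^esub> (?d \<otimes>\<^bsub>Q\<^esub> inv\<^bsub>Q\<^esub> ?B a) | v. v \<in> ?V}"
  proof -
    have "?d \<otimes>\<^bsub>Q\<^esub> inv\<^bsub>Q\<^esub> (?B a \<otimes>\<^bsub>Q\<^esub> v) = inv\<^bsub>Q\<^esub> v \<otimes>\<^bsub>Q\<^esub> (?d \<otimes>\<^bsub>Q\<^esub> inv\<^bsub>Q\<^esub> ?B a)" if "v \<in> ?V" for v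
      using d B[OF a(1)] V.mem_carrier[OF that]
      by (simp add: Q.inv_mult Q.m_ac del: mult_FactGroup)
    then show ?thesis by blast
  qed
  also have "\<dots> = {v \<otimes>\<^bsub>Q\<^esub> (?d \<otimes>\<^bsub>Q\<^esub> inv\<^bsub>Q\<^esub> ?B a) | v. v \<in> ?V}"
  proof -
    have "inv\<^bsub>Q\<^esub> v \<in> ?V \<and> inv\<^bsub>Q\<^esub> (inv\<^bsub>Q\<^esub> v) = v" if "v \<in> ?V" for v
      using V.m_inv_closed[OF that] Q.inv_inv[OF V.mem_carrier[OF that]] by blast
    then have img: "?V = m_inv Q ` ?V"
      by (metis (no_types, lifting) image_eqI image_subsetI subsetI subset_antisym)
    have "{f v | v. v \<in> ?V} = {f (inv\<^bsub>Q\<^esub> v) | v. v \<in> ?V}" for f :: "'c set \<Rightarrow> 'c set"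
      by (subst img) blast
    then show ?thesis by (rule sym)
  qed
  also have "\<dots> = ?V #>\<^bsub>Q\<^esub> (?d \<otimes>\<^bsub>Q\<^esub> inv\<^bsub>Q\<^esub> ?B a)"
    by (auto simp: r_coset_def simp del: mult_FactGroup)
  finally show ?thesis
    using d B[OF a(1)] unfolding carrier_FactGroup[of Q]
    by (metis Q.inv_closed Q.m_closed imageI)
qed

end

end

theory Submission
  imports Defs
begin

text \<open>
  With \<open>a = (n', k')\<close>, the equation \<open>g x\<^sub>1 = x\<^sub>2 g\<close> amounts to \<open>\<Lambda> a = p\<^sub>1 - p\<^sub>2\<close> and
  \<open>c\<^sub>1 - c\<^sub>2 = B\<^sub>1 a\<close> in \<open>C / Im n\<close>: the \<open>p\<close>-component of \<open>g\<close> moves the \<open>c\<close>-coordinate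
  through all of \<open>Im n\<close>, which absorbs \<open>n'(k'\<^sub>p n) = n(k'\<^sub>p n')\<close>. Hence \<open>x\<^sub>1\<close> and \<open>x\<^sub>2\<close> are
  conjugate iff \<open>0 \<in> V\<^sub>1\<^sub>2\<close>. The cocycle rule \<open>B\<^sub>0 (a + b) = B\<^sub>0 a + B\<^sub>1 b\<close> for
  \<open>\<Lambda> a = p\<^sub>0 - p\<^sub>1\<close> gives \<open>V\<^sub>0\<^sub>1 + V\<^sub>1\<^sub>2 = V\<^sub>0\<^sub>2\<close>, so this happens iff \<open>V\<^sub>0\<^sub>1 = V\<^sub>0\<^sub>2\<close>.
\<close>

section \<open>Semidirect products and cancellation rules in groups\<close>

text \<open>Applied below with \<open>heisenberg N P C pair\<close> as \<open>A\<close> and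
  \<open>K\<close>, acting by evaluation, as \<open>B\<close>; this makes the extended Heisenberg
  group a group.\<close>

lemma group_semidirect:
  assumes "group A" and "group B"
    and hom: "\<And>b. b \<in> carrier B \<Longrightarrow> \<phi> b \<in> hom A A"
    and comp: "\<And>b b' a. b \<in> carrier B \<Longrightarrow> b' \<in> carrier B \<Longrightarrow> a \<in> carrier A \<Longrightarrow>
      \<phi> (b \<otimes>\<^bsub>B\<^esub> b') a = \<phi> b (\<phi> b' a)"
    and one: "\<And>a. a \<in> carrier A \<Longrightarrow> \<phi> \<one>\<^bsub>B\<^esub> a = a"
  shows "group (semidirect A B \<phi>)"
proof -
  interpret A: group A by fact
  interpret B: group B by fact
  have closed: "\<phi> b a \<in> carrier A" if "b \<in> carrier B" "a \<in> carrier A" for a b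
    using hom[OF that(1)] that(2) by (auto simp: hom_def)
  have mult: "\<phi> b (x \<otimes>\<^bsub>A\<^esub> y) = \<phi> b x \<otimes>\<^bsub>A\<^esub> \<phi> b y"
    if "b \<in> carrier B" "x \<in> carrier A" "y \<in> carrier A" for b x y
    using hom[OF that(1)] that(2,3) by (auto simp: hom_def)
  have hom_one: "\<phi> b \<one>\<^bsub>A\<^esub> = \<one>\<^bsub>A\<^esub>" if "b \<in> carrier B" for b
    using group_hom.hom_one[of A A "\<phi> b"] hom[OF that]
    by (simp add: group_hom_def group_hom_axioms_def A.is_group)
  show ?thesis
  proof (rule groupI)
    fix x assume "x \<in> carrier (semidirect A B \<phi>)"
    then obtain a b where x: "x = (a, b)" "a \<in> carrier A" "b \<in> carrier B"
      by (auto simp: semidirect_def)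
    \<comment> \<open>The second coordinate of a left inverse must be \<open>inv b\<close>; solving
      \<open>a' \<otimes> \<phi> (inv b) a = \<one>\<close> then forces the first one.\<close>
    let ?y = "(\<phi> (inv\<^bsub>B\<^esub> b) (inv\<^bsub>A\<^esub> a), inv\<^bsub>B\<^esub> b)"
    show "\<exists>y\<in>carrier (semidirect A B \<phi>). y \<otimes>\<^bsub>semidirect A B \<phi>\<^esub> x = \<one>\<^bsub>semidirect A B \<phi>\<^esub>"
      using x by (intro bexI[of _ ?y])
        (simp_all add: semidirect_def closed hom_one mult[symmetric])
  qed (auto simp: semidirect_def closed mult comp one A.m_assoc B.m_assoc)
qed

text \<open>Clearing the inverse lets conjugacy be read off from two products, so inverses in the
  extended Heisenberg group never have to be computed.\<close>

lemma (in group) conjugate_in_iff: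
  assumes "x \<in> carrier G" "y \<in> carrier G"
  shows "conjugate_in G x y \<longleftrightarrow> (\<exists>g\<in>carrier G. g \<otimes> x = y \<otimes> g)"
  unfolding conjugate_in_def
  using assms by (metis inv_solve_right m_closed)

lemma (in comm_group) div_eq_div_iff:
  assumes "a \<in> carrier G" "b \<in> carrier G" "c \<in> carrier G" "d \<in> carrier G"
  shows "a \<otimes> inv b = c \<otimes> inv d \<longleftrightarrow> a \<otimes> d = c \<otimes> b"
proof -
  have "a \<otimes> inv b = c \<otimes> inv d \<longleftrightarrow> a = c \<otimes> inv d \<otimes> b"
    using assms by (simp add: inv_solve_right')
  also have "c \<otimes> inv d \<otimes> b = c \<otimes> b \<otimes> inv d"
    using assms by (simp add: m_ac)
  also have "a = \<dots> \<longleftrightarrow> a \<otimes> d = c \<otimes> b"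
    using assms by (simp add: inv_solve_right eq_commute)
  finally show ?thesis .
qed

text \<open>Cross-multiplying leaves the common factors \<open>x\<close> and \<open>y\<close> on
  both sides. Shaped for comparing an element of \<open>V\<^sub>0\<^sub>1\<close> with one of
  \<open>V\<^sub>0\<^sub>2\<close>: \<open>d\<close> becomes the class of
  \<open>c\<^sub>1 - c\<^sub>2\<close>, and \<open>z\<close> a value of
  \<open>B\<^sub>1\<close>.\<close>

lemma (in comm_group) div_eq_mult_div_iff:
  assumes "x \<in> carrier G" "y \<in> carrier G" "d \<in> carrier G" "z \<in> carrier G"
  shows "x \<otimes> inv y = x \<otimes> d \<otimes> inv (y \<otimes> z) \<longleftrightarrow> d = z"
proof -
  have "x \<otimes> inv y = x \<otimes> d \<otimes> inv (y \<otimes> z) \<longleftrightarrow> x \<otimes> (y \<otimes> z) = x \<otimes> (y \<otimes> d)"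
    by (subst div_eq_div_iff) (use assms in \<open>simp_all add: m_ac\<close>)
  then show ?thesis
    using assms by auto
qed

lemma (in group) div_mult_div:
  assumes "a \<in> carrier G" "b \<in> carrier G" "c \<in> carrier G"
  shows "a \<otimes> inv b \<otimes> (b \<otimes> inv c) = a \<otimes> inv c"
  using assms by (simp add: m_assoc) (simp add: m_assoc[symmetric])

section \<open>The group of graded automorphisms and the extended Heisenberg group\<close>

context heis_data
begin

lemma heis_Aut_gr_hom:
  assumes "k \<in> carrier (heis_Aut_gr N P C pair)"
  shows "k \<in> hom (heisenberg N P C pair) (heisenberg N P C pair)"
  using assms
  by (auto simp: heis_Aut_gr_def Aut_gr_def graded_auts_def heisenberg_def Let_def auto_def)

lemma heis_Aut_gr_mult_apply:
  assumes "k \<in> carrier (heis_Aut_gr N P C pair)" "j \<in> carrier (heis_Aut_gr N P C pair)"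
    and "x \<in> carrier (heisenberg N P C pair)"
  shows "(k \<otimes>\<^bsub>heis_Aut_gr N P C pair\<^esub> j) x = k (j x)"
  using assms
  by (auto simp: heis_Aut_gr_def Aut_gr_def graded_auts_def Let_def AutoGroup_def
      BijGroup_def auto_def compose_def heisenberg_def)

lemma heis_Aut_gr_one_apply:
  "x \<in> carrier (heisenberg N P C pair) \<Longrightarrow> \<one>\<^bsub>heis_Aut_gr N P C pair\<^esub> x = x"
  by (auto simp: heis_Aut_gr_def Aut_gr_def AutoGroup_def BijGroup_def heisenberg_def)

text \<open>On the carrier, \<open>graded_aut_apply\<close> expresses an automorphism through its
  two components; off the carrier both functions are \<open>undefined\<close>, because members of
  \<open>auto\<close> are extensional.\<close>

lemma heis_Aut_gr_eqI:
  assumes k: "k \<in> carrier (heis_Aut_gr N P C pair)" and j: "j \<in> carrier (heis_Aut_gr N P C pair)"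
    and p: "\<And>n. n \<in> carrier N \<Longrightarrow> aut_p P C k n = aut_p P C j n"
    and c: "\<And>n. n \<in> carrier N \<Longrightarrow> aut_c P C k n = aut_c P C j n"
  shows "k = j"
proof (rule extensionalityI)
  show "k \<in> extensional (carrier (heisenberg N P C pair))"
    and "j \<in> extensional (carrier (heisenberg N P C pair))"
    using k j by (auto simp: heis_Aut_gr_def Aut_gr_def graded_auts_def Let_def auto_def Bij_def
        heisenberg_def)
  show "k x = j x" if "x \<in> carrier (heisenberg N P C pair)" for x
    using that p c by (auto simp: heis_carrier graded_aut_apply(1)[OF k] graded_aut_apply(1)[OF j])
qed

text \<open>By \<open>aut_mult_comp\<close>, composition adds both components, and these lie in
  abelian groups.\<close>

lemma comm_group_Aut_gr: "comm_group (heis_Aut_gr N P C pair)"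
proof -
  interpret group "heis_Aut_gr N P C pair" by (rule group_Aut_gr)
  show ?thesis
  proof (rule group_comm_groupI)
    fix k j assume kj: "k \<in> carrier (heis_Aut_gr N P C pair)" "j \<in> carrier (heis_Aut_gr N P C pair)"
    note closed = graded_aut_apply(2,3)[OF _ P.one_closed C.one_closed]
    show "k \<otimes>\<^bsub>heis_Aut_gr N P C pair\<^esub> j = j \<otimes>\<^bsub>heis_Aut_gr N P C pair\<^esub> k"
      using kj by (intro heis_Aut_gr_eqI)
        (simp_all add: aut_mult_comp closed P.m_comm C.m_comm)
  qed
qed

lemma group_ext_heisenberg:
  assumes K: "subgroup K (heis_Aut_gr N P C pair)"
  shows "group (ext_heisenberg N P C pair K)"
  unfolding ext_heisenberg_def
proof (rule group_semidirect[OF group_heisenberg])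
  show "group (heis_Aut_gr N P C pair\<lparr>carrier := K\<rparr>)"
    using group.subgroup_imp_group[OF group_Aut_gr K] .
qed (auto simp: heis_Aut_gr_hom heis_Aut_gr_mult_apply heis_Aut_gr_one_apply
      subsetD[OF subgroup.subset[OF K]])

lemma ext_heis_carrier:
  "carrier (ext_heisenberg N P C pair K) = ((carrier P \<times> carrier C) \<times> carrier N) \<times> K"
  by (simp add: ext_heisenberg_def semidirect_def heis_carrier)

text \<open>The last two coordinates of a product are the products in N and in
  \<open>heis_Aut_gr N P C pair\<close>. Both groups are abelian, so conjugation cannot change these
  coordinates.\<close>

lemma conjugate_in_ext_heisenbergD:
  assumes K: "subgroup K (heis_Aut_gr N P C pair)"
    and x: "(((p\<^sub>1, c\<^sub>1), n\<^sub>1), k\<^sub>1) \<in> carrier (ext_heisenberg N P C pair K)"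
      "(((p\<^sub>2, c\<^sub>2), n\<^sub>2), k\<^sub>2) \<in> carrier (ext_heisenberg N P C pair K)"
    and conj: "conjugate_in (ext_heisenberg N P C pair K) (((p\<^sub>1, c\<^sub>1), n\<^sub>1), k\<^sub>1) (((p\<^sub>2, c\<^sub>2), n\<^sub>2), k\<^sub>2)"
  shows "n\<^sub>1 = n\<^sub>2" and "k\<^sub>1 = k\<^sub>2"
proof -
  interpret A: comm_group "heis_Aut_gr N P C pair" by (rule comm_group_Aut_gr)
  have KA: "j \<in> carrier (heis_Aut_gr N P C pair)" if "j \<in> K" for j
    using subgroup.subset[OF K] that by blast
  obtain p c m j where g: "p \<in> carrier P" "c \<in> carrier C" "m \<in> carrier N" "j \<in> K"
    and "(((p, c), m), j) \<otimes>\<^bsub>ext_heisenberg N P C pair K\<^esub> (((p\<^sub>1, c\<^sub>1), n\<^sub>1), k\<^sub>1) =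
      (((p\<^sub>2, c\<^sub>2), n\<^sub>2), k\<^sub>2) \<otimes>\<^bsub>ext_heisenberg N P C pair K\<^esub> (((p, c), m), j)"
    using conj unfolding group.conjugate_in_iff[OF group_ext_heisenberg[OF K] x]
    by (auto simp: ext_heis_carrier)
  then have "m \<otimes>\<^bsub>N\<^esub> n\<^sub>1 = n\<^sub>2 \<otimes>\<^bsub>N\<^esub> m"
    and "j \<otimes>\<^bsub>heis_Aut_gr N P C pair\<^esub> k\<^sub>1 = k\<^sub>2 \<otimes>\<^bsub>heis_Aut_gr N P C pair\<^esub> j"
    using x KA by (simp_all add: ext_heis_carrier ext_heis_mult)
  then show "n\<^sub>1 = n\<^sub>2" "k\<^sub>1 = k\<^sub>2"
    using g x KA
    by (simp_all add: ext_heis_carrier N.m_comm[of m] A.m_comm[of j])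
qed

end

section \<open>Classes modulo Im n and the cocycle rule\<close>

context ext_heis_data
begin

abbreviation cls where "cls c \<equiv> Im_n P pair n #>\<^bsub>C\<^esub> c"

lemma cls_closed [simp]: "c \<in> carrier C \<Longrightarrow> cls c \<in> carrier Q"
  by (rule group_hom.hom_closed[OF coset_hom])

lemma cls_mult:
  "c \<in> carrier C \<Longrightarrow> d \<in> carrier C \<Longrightarrow> cls (c \<otimes>\<^bsub>C\<^esub> d) = cls c \<otimes>\<^bsub>Q\<^esub> cls d"
  by (rule group_hom.hom_mult[OF coset_hom])

lemma cls_inv: "c \<in> carrier C \<Longrightarrow> cls (inv\<^bsub>C\<^esub> c) = inv\<^bsub>Q\<^esub> cls c"
  by (rule group_hom.hom_inv[OF coset_hom])

lemma cls_eq_one_iff: "c \<in> carrier C \<Longrightarrow> cls c = \<one>\<^bsub>Q\<^esub> \<longleftrightarrow> (\<exists>p\<in>carrier P. c = pair n p)"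
  using C.coset_join1[OF _ _ Im_n_subgroup, of c]
    C.coset_join2[OF _ Im_n_subgroup, of c]
  by (auto simp: Im_n_def)

lemma cls_pair_n [simp]: "p \<in> carrier P \<Longrightarrow> cls (pair n p) = \<one>\<^bsub>Q\<^esub>"
  using n by (simp add: cls_eq_one_iff del: one_FactGroup) blast

text \<open>The inverse-free side is what the P-coordinates of
  \<open>g x\<^sub>i = x\<^sub>j g\<close> give once the P-coordinate of \<open>g\<close> is
  cancelled.\<close>

lemma Lam_eq_iff:
  assumes "p\<^sub>i \<in> carrier P" "p\<^sub>j \<in> carrier P" "m \<in> carrier N" "j \<in> K"
  shows "Lam P C n k (m, j) = p\<^sub>i \<otimes>\<^bsub>P\<^esub> inv\<^bsub>P\<^esub> p\<^sub>j \<longleftrightarrow>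
    p\<^sub>i \<otimes>\<^bsub>P\<^esub> aut_p P C j n = p\<^sub>j \<otimes>\<^bsub>P\<^esub> aut_p P C k m"
  using assms n k
  by (subst eq_commute) (simp add: Lam_def P.div_eq_div_iff P.m_comm[of p\<^sub>j])

text \<open>By \<open>beta_mult\<close>, \<open>beta p\<^sub>0\<close> fails to be additive by the
  term \<open>m(k\<^sub>p l)\<close>, where \<open>m\<close> and \<open>l\<close> are the N-parts of
  \<open>a\<close> and \<open>b\<close>. The condition on \<open>a\<close> trades this defect for
  the replacement of \<open>p\<^sub>0\<close> by \<open>p\<^sub>1\<close> in the value at
  \<open>b\<close>, up to an element of Im n, which dies in \<open>Q\<close>.\<close>

lemma cls_beta_mult:
  assumes p: "p\<^sub>0 \<in> carrier P" "p\<^sub>1 \<in> carrier P" and a: "a \<in> carrier NK" and b: "b \<in> carrier NK"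
    and La: "Lam P C n k a = p\<^sub>0 \<otimes>\<^bsub>P\<^esub> inv\<^bsub>P\<^esub> p\<^sub>1"
  shows "cls (beta p\<^sub>0 (a \<otimes>\<^bsub>NK\<^esub> b)) = cls (beta p\<^sub>0 a) \<otimes>\<^bsub>Q\<^esub> cls (beta p\<^sub>1 b)"
proof -
  interpret Q: comm_group Q by (rule comm_group_Q)
  obtain m i l j where ab: "a = (m, i)" "b = (l, j)"
    and mem: "m \<in> carrier N" "i \<in> K" "l \<in> carrier N" "j \<in> K"
    using a b by auto
  have "p\<^sub>0 \<otimes>\<^bsub>P\<^esub> aut_p P C i n = p\<^sub>1 \<otimes>\<^bsub>P\<^esub> aut_p P C k m"
    using La Lam_eq_iff p mem by (simp add: ab)
  then have "pair l (p\<^sub>0 \<otimes>\<^bsub>P\<^esub> aut_p P C i n) = pair l (p\<^sub>1 \<otimes>\<^bsub>P\<^esub> aut_p P C k m)"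
    by simp
  \<comment> \<open>The symmetry \<open>pair_aut_sym\<close> turns \<open>l(k\<^sub>p m)\<close>
    into the defect \<open>m(k\<^sub>p l)\<close> and \<open>l(i\<^sub>p n)\<close> into
    \<open>n(i\<^sub>p l)\<close>, which lies in Im n.\<close>
  then have eq: "pair l p\<^sub>0 \<otimes>\<^bsub>C\<^esub> pair n (aut_p P C i l) = pair l p\<^sub>1 \<otimes>\<^bsub>C\<^esub> pair m (aut_p P C k l)"
    using p mem n k
    by (simp add: pair_mult_right pair_aut_sym[OF K_gr, of k l m] pair_aut_sym[OF K_gr, of i l n])
  \<comment> \<open>Only the last term of \<open>beta p b\<close> involves \<open>p\<close>, so the
    equation just found can be added to the remaining terms.\<close>
  have "pair m (aut_p P C k l) \<otimes>\<^bsub>C\<^esub> beta p\<^sub>0 b = pair n (aut_p P C i l) \<otimes>\<^bsub>C\<^esub> beta p\<^sub>1 b"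
  proof -
    have "pair m (aut_p P C k l) \<otimes>\<^bsub>C\<^esub> inv\<^bsub>C\<^esub> pair l p\<^sub>0 = pair n (aut_p P C i l) \<otimes>\<^bsub>C\<^esub> inv\<^bsub>C\<^esub> pair l p\<^sub>1"
      using eq p mem n k
      by (subst C.div_eq_div_iff) (simp_all add: C.m_comm)
    then show ?thesis
      using p mem n k by (simp add: ab beta_def C.m_lcomm[of "pair _ _"])
  qed
  then have "beta p\<^sub>0 (a \<otimes>\<^bsub>NK\<^esub> b) = pair n (aut_p P C i l) \<otimes>\<^bsub>C\<^esub> (beta p\<^sub>0 a \<otimes>\<^bsub>C\<^esub> beta p\<^sub>1 b)"
    using p a b mem n k
    by (simp add: beta_mult ab C.m_lcomm[of _ "beta p\<^sub>0 (m, i)"] del: mult_DirProd)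
  then show ?thesis
    using p a b mem n
    by (simp add: cls_mult del: mult_FactGroup carrier_FactGroup one_FactGroup carrier_DirProd)
qed

lemma V_set_eq:
  assumes "p\<^sub>i \<in> carrier P" "c\<^sub>i \<in> carrier C" "c\<^sub>j \<in> carrier C"
  shows "V_set N P C pair K (((p\<^sub>i, c\<^sub>i), n), k) (((p\<^sub>j, c\<^sub>j), n), k) =
    {cls (c\<^sub>i \<otimes>\<^bsub>C\<^esub> inv\<^bsub>C\<^esub> c\<^sub>j) \<otimes>\<^bsub>Q\<^esub> inv\<^bsub>Q\<^esub> cls (beta p\<^sub>i a) | a.
      a \<in> carrier NK \<and> Lam P C n k a = p\<^sub>i \<otimes>\<^bsub>P\<^esub> inv\<^bsub>P\<^esub> p\<^sub>j}"
  by (auto simp: V_set_def Let_def B_map_beta)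

text \<open>Two cosets agree iff the difference of their representatives lies in the subgroup. The
  witness \<open>a\<close> says that the fibre of \<Lambda> over which \<open>V_set\<close> ranges
  is nonempty.\<close>

lemma R_inv_eq_iff:
  assumes "p\<^sub>i \<in> carrier P" "p\<^sub>j \<in> carrier P"
  shows "R_inv N P C K (((p\<^sub>i, c\<^sub>i), n), k) = R_inv N P C K (((p\<^sub>j, c\<^sub>j), n), k) \<longleftrightarrow>
    (\<exists>a\<in>carrier NK. Lam P C n k a = p\<^sub>i \<otimes>\<^bsub>P\<^esub> inv\<^bsub>P\<^esub> p\<^sub>j)"
proof -
  let ?I = "Im_Lam N P C K n k"
  have "?I #>\<^bsub>P\<^esub> p\<^sub>i = ?I #>\<^bsub>P\<^esub> p\<^sub>j \<longleftrightarrow> p\<^sub>i \<in> ?I #>\<^bsub>P\<^esub> p\<^sub>j"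
    using P.repr_independence[OF _ assms(2) Im_Lam_subgroup] P.rcos_self[OF assms(1) Im_Lam_subgroup]
    by auto
  also have "\<dots> \<longleftrightarrow> p\<^sub>i \<otimes>\<^bsub>P\<^esub> inv\<^bsub>P\<^esub> p\<^sub>j \<in> ?I"
    using subgroup.rcos_module[OF Im_Lam_subgroup P.is_group assms(2,1)] .
  also have "\<dots> \<longleftrightarrow> (\<exists>a\<in>carrier NK. Lam P C n k a = p\<^sub>i \<otimes>\<^bsub>P\<^esub> inv\<^bsub>P\<^esub> p\<^sub>j)"
  proof -
    have NK: "carrier NK = carrier N \<times> K" by simp
    show ?thesis unfolding Im_Lam_def NK image_iff by (intro bex_cong refl eq_commute)
  qed
  finally show ?thesis by (simp only: R_inv_def prod.case)
qed

section \<open>The conjugacy criterion for fixed n and k\<close>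

text \<open>The equation \<open>g x\<^sub>1 = x\<^sub>2 g\<close> is split into coordinates. The
  P-coordinate of \<open>g\<close> survives only inside \<open>pair n\<close>, so quantifying over
  it weakens an equality in C to an equality in \<open>Q\<close>.\<close>

lemma conjugate_in_ext_heisenberg_iff:
  assumes p: "p\<^sub>1 \<in> carrier P" "p\<^sub>2 \<in> carrier P" and c: "c\<^sub>1 \<in> carrier C" "c\<^sub>2 \<in> carrier C"
  shows "conjugate_in (ext_heisenberg N P C pair K) (((p\<^sub>1, c\<^sub>1), n), k) (((p\<^sub>2, c\<^sub>2), n), k) \<longleftrightarrow>
    (\<exists>a\<in>carrier NK. Lam P C n k a = p\<^sub>1 \<otimes>\<^bsub>P\<^esub> inv\<^bsub>P\<^esub> p\<^sub>2 \<and>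
      cls (c\<^sub>1 \<otimes>\<^bsub>C\<^esub> inv\<^bsub>C\<^esub> c\<^sub>2) = cls (beta p\<^sub>1 a))"
proof -
  let ?G = "ext_heisenberg N P C pair K"
  let ?x = "(((p\<^sub>1, c\<^sub>1), n), k)" and ?y = "(((p\<^sub>2, c\<^sub>2), n), k)"
  interpret A: comm_group "heis_Aut_gr N P C pair" by (rule comm_group_Aut_gr)
  interpret Q: comm_group Q by (rule comm_group_Q)
  \<comment> \<open>The N- and K-coordinates agree by commutativity; \<open>p\<close> cancels in the
    P-coordinate and \<open>c\<close> in the C-coordinate.\<close>
  have comm: "(((p, c), m), j) \<otimes>\<^bsub>?G\<^esub> ?x = ?y \<otimes>\<^bsub>?G\<^esub> (((p, c), m), j) \<longleftrightarrow>
      Lam P C n k (m, j) = p\<^sub>1 \<otimes>\<^bsub>P\<^esub> inv\<^bsub>P\<^esub> p\<^sub>2 \<and>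
      c\<^sub>1 \<otimes>\<^bsub>C\<^esub> inv\<^bsub>C\<^esub> c\<^sub>2 \<otimes>\<^bsub>C\<^esub> inv\<^bsub>C\<^esub> beta p\<^sub>1 (m, j) =
        pair n (p \<otimes>\<^bsub>P\<^esub> (aut_p P C k m \<otimes>\<^bsub>P\<^esub> inv\<^bsub>P\<^esub> aut_p P C j m))"
    if g: "p \<in> carrier P" "c \<in> carrier C" "m \<in> carrier N" "j \<in> K" for p c m j
  proof -
    have "p \<otimes>\<^bsub>P\<^esub> (p\<^sub>1 \<otimes>\<^bsub>P\<^esub> aut_p P C j n) = p\<^sub>2 \<otimes>\<^bsub>P\<^esub> (p \<otimes>\<^bsub>P\<^esub> aut_p P C k m) \<longleftrightarrow>
        Lam P C n k (m, j) = p\<^sub>1 \<otimes>\<^bsub>P\<^esub> inv\<^bsub>P\<^esub> p\<^sub>2"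
      using g p n k by (simp add: Lam_eq_iff P.m_lcomm[of p\<^sub>2])
    moreover have "c \<otimes>\<^bsub>C\<^esub> (c\<^sub>1 \<otimes>\<^bsub>C\<^esub> aut_c P C j n \<otimes>\<^bsub>C\<^esub> pair m (p\<^sub>1 \<otimes>\<^bsub>P\<^esub> aut_p P C j n)) =
        c\<^sub>2 \<otimes>\<^bsub>C\<^esub> (c \<otimes>\<^bsub>C\<^esub> aut_c P C k m \<otimes>\<^bsub>C\<^esub> pair n (p \<otimes>\<^bsub>P\<^esub> aut_p P C k m)) \<longleftrightarrow>
        c\<^sub>1 \<otimes>\<^bsub>C\<^esub> inv\<^bsub>C\<^esub> c\<^sub>2 \<otimes>\<^bsub>C\<^esub> inv\<^bsub>C\<^esub> beta p\<^sub>1 (m, j) =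
        pair n (p \<otimes>\<^bsub>P\<^esub> (aut_p P C k m \<otimes>\<^bsub>P\<^esub> inv\<^bsub>P\<^esub> aut_p P C j m))"
        (is "?l = ?r \<longleftrightarrow> ?s = ?t")
    proof -
      \<comment> \<open>With these abbreviations the C-coordinate reads
        \<open>u + z = w + v\<close>, and the claimed equation is its rearrangement
        \<open>u - v = w - z\<close>.\<close>
      let ?u = "c\<^sub>1 \<otimes>\<^bsub>C\<^esub> aut_c P C j n \<otimes>\<^bsub>C\<^esub> pair m p\<^sub>1" and ?v = "c\<^sub>2 \<otimes>\<^bsub>C\<^esub> aut_c P C k m"
      let ?w = "pair n (p \<otimes>\<^bsub>P\<^esub> aut_p P C k m)" and ?z = "pair m (aut_p P C j n)"
      have l: "?l = c \<otimes>\<^bsub>C\<^esub> (?u \<otimes>\<^bsub>C\<^esub> ?z)"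
        using g p c n k by (simp add: pair_mult_right C.m_assoc)
      have r: "?r = c \<otimes>\<^bsub>C\<^esub> (?w \<otimes>\<^bsub>C\<^esub> ?v)"
        using g p c n k by (simp add: C.m_ac)
      have s: "?s = ?u \<otimes>\<^bsub>C\<^esub> inv\<^bsub>C\<^esub> ?v"
        using g p c n k by (simp add: beta_def C.inv_mult C.m_ac)
      \<comment> \<open>Here \<open>m(j\<^sub>p n) = n(j\<^sub>p m)\<close> is what moves the term
        \<open>z\<close> into Im n.\<close>
      have t: "?t = ?w \<otimes>\<^bsub>C\<^esub> inv\<^bsub>C\<^esub> ?z"
        using g p c n k by (simp add: pair_mult_right C.m_assoc pair_aut_sym[OF K_gr, of j m n])
      have closed: "?u \<in> carrier C" "?v \<in> carrier C" "?w \<in> carrier C" "?z \<in> carrier C"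
        using g p c n k by simp_all
      show ?thesis
        unfolding l r s t C.div_eq_div_iff[OF closed]
        by (rule C.Units_l_cancel[unfolded C.Units_eq, OF g(2)
              C.m_closed[OF closed(1,4)] C.m_closed[OF closed(3,2)]])
    qed
    ultimately show ?thesis
      using g p c n k by (simp add: ext_heis_mult K_gr N.m_comm[of m] A.m_comm[of j])
  qed
  have cls: "cls (c\<^sub>1 \<otimes>\<^bsub>C\<^esub> inv\<^bsub>C\<^esub> c\<^sub>2) = cls (beta p\<^sub>1 a) \<longleftrightarrow>
      (\<exists>q\<in>carrier P. c\<^sub>1 \<otimes>\<^bsub>C\<^esub> inv\<^bsub>C\<^esub> c\<^sub>2 \<otimes>\<^bsub>C\<^esub> inv\<^bsub>C\<^esub> beta p\<^sub>1 a = pair n q)"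
    if "a \<in> carrier NK" for a
  proof -
    have d: "c\<^sub>1 \<otimes>\<^bsub>C\<^esub> inv\<^bsub>C\<^esub> c\<^sub>2 \<in> carrier C" and b: "beta p\<^sub>1 a \<in> carrier C"
      using that p c beta_closed by auto
    have "cls (c\<^sub>1 \<otimes>\<^bsub>C\<^esub> inv\<^bsub>C\<^esub> c\<^sub>2) = cls (beta p\<^sub>1 a) \<longleftrightarrow>
        cls (c\<^sub>1 \<otimes>\<^bsub>C\<^esub> inv\<^bsub>C\<^esub> c\<^sub>2 \<otimes>\<^bsub>C\<^esub> inv\<^bsub>C\<^esub> beta p\<^sub>1 a) = \<one>\<^bsub>Q\<^esub>"
      unfolding cls_mult[OF d C.inv_closed[OF b]] cls_inv[OF b]
      using Q.inv_solve_right'[OF Q.one_closed cls_closed[OF d] cls_closed[OF b]]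
        Q.l_one[OF cls_closed[OF b]] by auto
    then show ?thesis using cls_eq_one_iff d b by simp
  qed
  \<comment> \<open>Translation by \<open>d\<close> permutes P, so the shifted argument still yields
    every value of \<open>pair n\<close>.\<close>
  have surj: "(\<exists>p\<in>carrier P. x = pair n (p \<otimes>\<^bsub>P\<^esub> d)) \<longleftrightarrow> (\<exists>q\<in>carrier P. x = pair n q)"
    if "d \<in> carrier P" for x d
    using that by (metis P.inv_closed P.inv_solve_right P.m_closed)
  have "conjugate_in ?G ?x ?y \<longleftrightarrow> (\<exists>g\<in>carrier ?G. g \<otimes>\<^bsub>?G\<^esub> ?x = ?y \<otimes>\<^bsub>?G\<^esub> g)"
    using p c n k by (intro group.conjugate_in_iff group_ext_heisenberg K) (auto simp: ext_heis_carrier)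
  \<comment> \<open>Putting \<open>m\<close> and \<open>j\<close> outermost allows \<open>p\<close>
    and \<open>c\<close> to be eliminated for each fixed \<open>(m, j)\<close>.\<close>
  also have "\<dots> \<longleftrightarrow> (\<exists>m\<in>carrier N. \<exists>j\<in>K. \<exists>p\<in>carrier P. \<exists>c\<in>carrier C.
      (((p, c), m), j) \<otimes>\<^bsub>?G\<^esub> ?x = ?y \<otimes>\<^bsub>?G\<^esub> (((p, c), m), j))"
    unfolding ext_heis_carrier by blast
  also have "\<dots> \<longleftrightarrow> (\<exists>m\<in>carrier N. \<exists>j\<in>K. Lam P C n k (m, j) = p\<^sub>1 \<otimes>\<^bsub>P\<^esub> inv\<^bsub>P\<^esub> p\<^sub>2 \<and>
      (\<exists>q\<in>carrier P. c\<^sub>1 \<otimes>\<^bsub>C\<^esub> inv\<^bsub>C\<^esub> c\<^sub>2 \<otimes>\<^bsub>C\<^esub> inv\<^bsub>C\<^esub> beta p\<^sub>1 (m, j) = pair n q))"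
  proof (intro bex_cong refl)
    fix m j assume mj: "m \<in> carrier N" "j \<in> K"
    let ?d = "aut_p P C k m \<otimes>\<^bsub>P\<^esub> inv\<^bsub>P\<^esub> aut_p P C j m"
    let ?e = "c\<^sub>1 \<otimes>\<^bsub>C\<^esub> inv\<^bsub>C\<^esub> c\<^sub>2 \<otimes>\<^bsub>C\<^esub> inv\<^bsub>C\<^esub> beta p\<^sub>1 (m, j)"
    have d: "?d \<in> carrier P" using k mj by simp
    have "(\<exists>p\<in>carrier P. \<exists>c\<in>carrier C.
        (((p, c), m), j) \<otimes>\<^bsub>?G\<^esub> ?x = ?y \<otimes>\<^bsub>?G\<^esub> (((p, c), m), j)) \<longleftrightarrow>
      (\<exists>p\<in>carrier P. \<exists>c\<in>carrier C. Lam P C n k (m, j) = p\<^sub>1 \<otimes>\<^bsub>P\<^esub> inv\<^bsub>P\<^esub> p\<^sub>2 \<and>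
        ?e = pair n (p \<otimes>\<^bsub>P\<^esub> ?d))"
      by (intro bex_cong refl comm mj)
    \<comment> \<open>The variable \<open>c\<close> no longer occurs, and \<open>carrier C\<close>
      is nonempty.\<close>
    also have "\<dots> \<longleftrightarrow> Lam P C n k (m, j) = p\<^sub>1 \<otimes>\<^bsub>P\<^esub> inv\<^bsub>P\<^esub> p\<^sub>2 \<and>
        (\<exists>p\<in>carrier P. ?e = pair n (p \<otimes>\<^bsub>P\<^esub> ?d))"
      using C.one_closed by blast
    finally show "(\<exists>p\<in>carrier P. \<exists>c\<in>carrier C.
        (((p, c), m), j) \<otimes>\<^bsub>?G\<^esub> ?x = ?y \<otimes>\<^bsub>?G\<^esub> (((p, c), m), j)) \<longleftrightarrow>
      Lam P C n k (m, j) = p\<^sub>1 \<otimes>\<^bsub>P\<^esub> inv\<^bsub>P\<^esub> p\<^sub>2 \<and> (\<exists>q\<in>carrier P. ?e = pair n q)"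
      unfolding surj[OF d] .
  qed
  also have "\<dots> \<longleftrightarrow> (\<exists>a\<in>carrier NK. Lam P C n k a = p\<^sub>1 \<otimes>\<^bsub>P\<^esub> inv\<^bsub>P\<^esub> p\<^sub>2 \<and>
      (\<exists>q\<in>carrier P. c\<^sub>1 \<otimes>\<^bsub>C\<^esub> inv\<^bsub>C\<^esub> c\<^sub>2 \<otimes>\<^bsub>C\<^esub> inv\<^bsub>C\<^esub> beta p\<^sub>1 a = pair n q))"
  proof -
    have NK: "carrier NK = carrier N \<times> K" by simp
    show ?thesis unfolding NK by blast
  qed
  also have "\<dots> \<longleftrightarrow> (\<exists>a\<in>carrier NK. Lam P C n k a = p\<^sub>1 \<otimes>\<^bsub>P\<^esub> inv\<^bsub>P\<^esub> p\<^sub>2 \<and>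
      cls (c\<^sub>1 \<otimes>\<^bsub>C\<^esub> inv\<^bsub>C\<^esub> c\<^sub>2) = cls (beta p\<^sub>1 a))"
    by (intro bex_cong refl conj_cong cls[symmetric])
  finally show ?thesis .
qed

section \<open>Comparison of the cosets \<open>V\<^sub>0\<^sub>1\<close> and
  \<open>V\<^sub>0\<^sub>2\<close>\<close>

text \<open>An element \<open>b\<close> with \<open>\<Lambda> b = p\<^sub>1 - p\<^sub>2\<close>
  translates the fibre of \<Lambda> over \<open>p\<^sub>0 - p\<^sub>1\<close> onto the fibre over
  \<open>p\<^sub>0 - p\<^sub>2\<close>, and by the cocycle rule the indexed elements match iff
  \<open>b\<close> satisfies the equation in \<open>Q\<close>. Conversely, a single common element
  yields such a \<open>b\<close>; the hypothesis \<open>R\<close> excludes that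
  \<open>V\<^sub>0\<^sub>1\<close> is empty.\<close>

lemma V_set_eq_iff:
  assumes p: "p\<^sub>0 \<in> carrier P" "p\<^sub>1 \<in> carrier P" "p\<^sub>2 \<in> carrier P"
    and c: "c\<^sub>0 \<in> carrier C" "c\<^sub>1 \<in> carrier C" "c\<^sub>2 \<in> carrier C"
    and R: "R_inv N P C K (((p\<^sub>0, c\<^sub>0), n), k) = R_inv N P C K (((p\<^sub>1, c\<^sub>1), n), k)"
  shows "V_set N P C pair K (((p\<^sub>0, c\<^sub>0), n), k) (((p\<^sub>1, c\<^sub>1), n), k) =
      V_set N P C pair K (((p\<^sub>0, c\<^sub>0), n), k) (((p\<^sub>2, c\<^sub>2), n), k) \<longleftrightarrow>
    (\<exists>a\<in>carrier NK. Lam P C n k a = p\<^sub>1 \<otimes>\<^bsub>P\<^esub> inv\<^bsub>P\<^esub> p\<^sub>2 \<and>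
      cls (c\<^sub>1 \<otimes>\<^bsub>C\<^esub> inv\<^bsub>C\<^esub> c\<^sub>2) = cls (beta p\<^sub>1 a))"
proof -
  interpret L: group_hom NK P "Lam P C n k" by (rule Lam_hom)
  interpret Q: comm_group Q by (rule comm_group_Q)
  let ?D = "\<lambda>c d. cls (c \<otimes>\<^bsub>C\<^esub> inv\<^bsub>C\<^esub> d)"
  let ?F = "\<lambda>c a. ?D c\<^sub>0 c \<otimes>\<^bsub>Q\<^esub> inv\<^bsub>Q\<^esub> cls (beta p\<^sub>0 a)"
  have D: "?D c\<^sub>0 c\<^sub>2 = ?D c\<^sub>0 c\<^sub>1 \<otimes>\<^bsub>Q\<^esub> ?D c\<^sub>1 c\<^sub>2"
    using c cls_mult[of "c\<^sub>0 \<otimes>\<^bsub>C\<^esub> inv\<^bsub>C\<^esub> c\<^sub>1" "c\<^sub>1 \<otimes>\<^bsub>C\<^esub> inv\<^bsub>C\<^esub> c\<^sub>2"] by (simp add: C.div_mult_div)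
  have F: "?F c\<^sub>1 a = ?F c\<^sub>2 (a \<otimes>\<^bsub>NK\<^esub> b) \<longleftrightarrow> ?D c\<^sub>1 c\<^sub>2 = cls (beta p\<^sub>1 b)"
    if a: "a \<in> carrier NK" "Lam P C n k a = p\<^sub>0 \<otimes>\<^bsub>P\<^esub> inv\<^bsub>P\<^esub> p\<^sub>1" and b: "b \<in> carrier NK" for a b
  proof -
    have "cls (beta p\<^sub>0 a) \<in> carrier Q" "cls (beta p\<^sub>1 b) \<in> carrier Q"
      "?D c\<^sub>0 c\<^sub>1 \<in> carrier Q" "?D c\<^sub>1 c\<^sub>2 \<in> carrier Q"
      using a b p c by (simp_all del: carrier_FactGroup carrier_DirProd)
    then show ?thesis
      unfolding D cls_beta_mult[OF p(1,2) a(1) b a(2)]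
      by (intro Q.div_eq_mult_div_iff)
  qed
  let ?V\<^sub>1 = "{?F c\<^sub>1 a | a. a \<in> carrier NK \<and> Lam P C n k a = p\<^sub>0 \<otimes>\<^bsub>P\<^esub> inv\<^bsub>P\<^esub> p\<^sub>1}"
  let ?V\<^sub>2 = "{?F c\<^sub>2 a | a. a \<in> carrier NK \<and> Lam P C n k a = p\<^sub>0 \<otimes>\<^bsub>P\<^esub> inv\<^bsub>P\<^esub> p\<^sub>2}"
  have "?V\<^sub>1 = ?V\<^sub>2 \<longleftrightarrow> (\<exists>a\<in>carrier NK. Lam P C n k a = p\<^sub>1 \<otimes>\<^bsub>P\<^esub> inv\<^bsub>P\<^esub> p\<^sub>2 \<and>
      ?D c\<^sub>1 c\<^sub>2 = cls (beta p\<^sub>1 a))"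
  proof
    assume eq: "?V\<^sub>1 = ?V\<^sub>2"
    obtain a where a: "a \<in> carrier NK" "Lam P C n k a = p\<^sub>0 \<otimes>\<^bsub>P\<^esub> inv\<^bsub>P\<^esub> p\<^sub>1"
      using R R_inv_eq_iff[OF p(1,2)] by blast
    then have "?F c\<^sub>1 a \<in> ?V\<^sub>2" unfolding eq[symmetric] by blast
    then obtain d where d: "d \<in> carrier NK" "Lam P C n k d = p\<^sub>0 \<otimes>\<^bsub>P\<^esub> inv\<^bsub>P\<^esub> p\<^sub>2"
      "?F c\<^sub>1 a = ?F c\<^sub>2 d" by blast
    \<comment> \<open>The common element has index \<open>a\<close> in
      \<open>V\<^sub>0\<^sub>1\<close> and \<open>d\<close> in \<open>V\<^sub>0\<^sub>2\<close>; the
      difference of the indices is the required witness.\<close>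
    let ?b = "inv\<^bsub>NK\<^esub> a \<otimes>\<^bsub>NK\<^esub> d"
    have b: "?b \<in> carrier NK" using a(1) d(1) by (rule L.G.m_closed[OF L.G.inv_closed])
    have ab: "a \<otimes>\<^bsub>NK\<^esub> ?b = d" using a(1) d(1) b L.G.inv_solve_left by metis
    have "Lam P C n k a \<otimes>\<^bsub>P\<^esub> Lam P C n k ?b = Lam P C n k d"
      unfolding L.hom_mult[OF a(1) b, symmetric] ab ..
    also have "\<dots> = Lam P C n k a \<otimes>\<^bsub>P\<^esub> (p\<^sub>1 \<otimes>\<^bsub>P\<^esub> inv\<^bsub>P\<^esub> p\<^sub>2)"
      using p by (simp add: a(2) d(2) P.div_mult_div)
    finally have "Lam P C n k ?b = p\<^sub>1 \<otimes>\<^bsub>P\<^esub> inv\<^bsub>P\<^esub> p\<^sub>2"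
      using p L.hom_closed[OF a(1)] L.hom_closed[OF b] by (metis P.inv_closed P.l_cancel P.m_closed)
    moreover have "?D c\<^sub>1 c\<^sub>2 = cls (beta p\<^sub>1 ?b)"
      using F[OF a b] d(3) unfolding ab by blast
    ultimately show "\<exists>a\<in>carrier NK. Lam P C n k a = p\<^sub>1 \<otimes>\<^bsub>P\<^esub> inv\<^bsub>P\<^esub> p\<^sub>2 \<and> ?D c\<^sub>1 c\<^sub>2 = cls (beta p\<^sub>1 a)"
      using b by blast
  next
    assume "\<exists>a\<in>carrier NK. Lam P C n k a = p\<^sub>1 \<otimes>\<^bsub>P\<^esub> inv\<^bsub>P\<^esub> p\<^sub>2 \<and> ?D c\<^sub>1 c\<^sub>2 = cls (beta p\<^sub>1 a)"
    then obtain b where b: "b \<in> carrier NK" "Lam P C n k b = p\<^sub>1 \<otimes>\<^bsub>P\<^esub> inv\<^bsub>P\<^esub> p\<^sub>2"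
      "?D c\<^sub>1 c\<^sub>2 = cls (beta p\<^sub>1 b)" by blast
    \<comment> \<open>Translation by \<open>b\<close> matches the two fibres of \<Lambda> in both
      directions.\<close>
    have Lab: "Lam P C n k (a \<otimes>\<^bsub>NK\<^esub> b) = p\<^sub>0 \<otimes>\<^bsub>P\<^esub> inv\<^bsub>P\<^esub> p\<^sub>2 \<longleftrightarrow> Lam P C n k a = p\<^sub>0 \<otimes>\<^bsub>P\<^esub> inv\<^bsub>P\<^esub> p\<^sub>1"
      if "a \<in> carrier NK" for a
    proof -
      have "p\<^sub>0 \<otimes>\<^bsub>P\<^esub> inv\<^bsub>P\<^esub> p\<^sub>2 = p\<^sub>0 \<otimes>\<^bsub>P\<^esub> inv\<^bsub>P\<^esub> p\<^sub>1 \<otimes>\<^bsub>P\<^esub> (p\<^sub>1 \<otimes>\<^bsub>P\<^esub> inv\<^bsub>P\<^esub> p\<^sub>2)"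
        using p by (simp add: P.div_mult_div)
      then show ?thesis
        using p L.hom_closed[OF that] unfolding L.hom_mult[OF that b(1)] b(2)
        by (metis P.inv_closed P.r_cancel P.m_closed)
    qed
    have F': "?F c\<^sub>1 a = ?F c\<^sub>2 (a \<otimes>\<^bsub>NK\<^esub> b)"
      if "a \<in> carrier NK" "Lam P C n k a = p\<^sub>0 \<otimes>\<^bsub>P\<^esub> inv\<^bsub>P\<^esub> p\<^sub>1" for a
      using F[OF that b(1)] b(3) by blast
    show "?V\<^sub>1 = ?V\<^sub>2"
    proof (intro subset_antisym subsetI)
      fix v assume "v \<in> ?V\<^sub>1"
      then obtain a where "a \<in> carrier NK" "Lam P C n k a = p\<^sub>0 \<otimes>\<^bsub>P\<^esub> inv\<^bsub>P\<^esub> p\<^sub>1" "v = ?F c\<^sub>1 a" by blast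
      then show "v \<in> ?V\<^sub>2" using F' Lab L.G.m_closed[OF _ b(1)] by blast
    next
      fix v assume "v \<in> ?V\<^sub>2"
      then obtain d where d: "d \<in> carrier NK" "Lam P C n k d = p\<^sub>0 \<otimes>\<^bsub>P\<^esub> inv\<^bsub>P\<^esub> p\<^sub>2" "v = ?F c\<^sub>2 d" by blast
      \<comment> \<open>Translating back by \<open>b\<close> gives the index in
        \<open>V\<^sub>0\<^sub>1\<close> of the same element.\<close>
      let ?a = "d \<otimes>\<^bsub>NK\<^esub> inv\<^bsub>NK\<^esub> b"
      have a: "?a \<in> carrier NK" by (rule L.G.m_closed[OF d(1) L.G.inv_closed[OF b(1)]])
      have ab: "?a \<otimes>\<^bsub>NK\<^esub> b = d" using b(1) d(1) a L.G.inv_solve_right by metis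
      have La: "Lam P C n k ?a = p\<^sub>0 \<otimes>\<^bsub>P\<^esub> inv\<^bsub>P\<^esub> p\<^sub>1" using Lab[OF a] d(2) unfolding ab by blast
      show "v \<in> ?V\<^sub>1" using F'[OF a La] a La d(3) unfolding ab by blast
    qed
  qed
  then show ?thesis unfolding V_set_eq[OF p(1) c(1,2)] V_set_eq[OF p(1) c(1,3)] .
qed

end

section \<open>Conjugacy classes through the four invariants\<close>

theorem mainTheorem1:
  fixes N :: "'n monoid" and P :: "'p monoid" and C :: "'c monoid"
    and pair :: "'n \<Rightarrow> 'p \<Rightarrow> 'c"
    and K :: "('n, 'p, 'c) heis_aut set"
    and x\<^sub>0 :: "'n \<Rightarrow> ('n, 'p, 'c) heis_aut \<Rightarrow> 'p set \<Rightarrow> ('n, 'p, 'c) ext_heis"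
    and p\<^sub>1 p\<^sub>2 :: 'p and c\<^sub>1 c\<^sub>2 :: 'c and n\<^sub>1 n\<^sub>2 :: 'n and k\<^sub>1 k\<^sub>2 :: "('n, 'p, 'c) heis_aut"
    and x\<^sub>1 x\<^sub>2 :: "('n, 'p, 'c) ext_heis"
  assumes "comm_group N" and "comm_group P" and "comm_group C"
    and "bilinear_pairing N P C pair"
    and "subgroup K (heis_Aut_gr N P C pair)"
    and "base_choice N P C pair K x\<^sub>0"
    and "x\<^sub>1 = (((p\<^sub>1, c\<^sub>1), n\<^sub>1), k\<^sub>1)" and "x\<^sub>2 = (((p\<^sub>2, c\<^sub>2), n\<^sub>2), k\<^sub>2)"
    and "x\<^sub>1 \<in> carrier (ext_heisenberg N P C pair K)"
    and "x\<^sub>2 \<in> carrier (ext_heisenberg N P C pair K)"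
  shows "conjugate_in (ext_heisenberg N P C pair K) x\<^sub>1 x\<^sub>2 \<longleftrightarrow>
    n\<^sub>1 = n\<^sub>2 \<and> k\<^sub>1 = k\<^sub>2 \<and> R_inv N P C K x\<^sub>1 = R_inv N P C K x\<^sub>2
      \<and> S_inv N P C pair K x\<^sub>0 x\<^sub>1 = S_inv N P C pair K x\<^sub>0 x\<^sub>2"
proof -
  interpret heis_data N P C pair
    using assms(1-4) by (simp add: heis_data_def heis_data_axioms_def)
  note carr = assms(9,10)[unfolded assms(7,8) ext_heis_carrier]
  have mem: "p\<^sub>1 \<in> carrier P" "c\<^sub>1 \<in> carrier C" "n\<^sub>1 \<in> carrier N" "k\<^sub>1 \<in> K"
    "p\<^sub>2 \<in> carrier P" "c\<^sub>2 \<in> carrier C"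
    using carr by auto
  \<comment> \<open>The coordinates of \<open>x\<^sub>1\<close> fix n and k;
    \<open>x\<^sub>2\<close> fits this setting once \<open>n\<^sub>1 = n\<^sub>2\<close> and
    \<open>k\<^sub>1 = k\<^sub>2\<close>, the case treated first.\<close>
  interpret ext_heis_data N P C pair K n\<^sub>1 k\<^sub>1
    by (intro ext_heis_data.intro ext_heis_data_axioms.intro heis_data_axioms assms(5) mem)
  have "conjugate_in (ext_heisenberg N P C pair K) x\<^sub>1 x\<^sub>2 \<longleftrightarrow>
      R_inv N P C K x\<^sub>1 = R_inv N P C K x\<^sub>2 \<and>
      S_inv N P C pair K x\<^sub>0 x\<^sub>1 = S_inv N P C pair K x\<^sub>0 x\<^sub>2"
    if eq: "n\<^sub>1 = n\<^sub>2" "k\<^sub>1 = k\<^sub>2"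
  proof -
    let ?r = "R_inv N P C K x\<^sub>1"
    have "?r \<in> carrier (P Mod Im_Lam N P C K n\<^sub>1 k\<^sub>1)"
      using mem by (auto simp: assms(7) R_inv_def carrier_FactGroup)
    with assms(6) mem obtain p\<^sub>0 c\<^sub>0 where x\<^sub>0: "p\<^sub>0 \<in> carrier P" "c\<^sub>0 \<in> carrier C"
      "x\<^sub>0 n\<^sub>1 k\<^sub>1 ?r = (((p\<^sub>0, c\<^sub>0), n\<^sub>1), k\<^sub>1)" "R_inv N P C K (((p\<^sub>0, c\<^sub>0), n\<^sub>1), k\<^sub>1) = ?r"
      unfolding base_choice_def by metis
    have x\<^sub>2: "x\<^sub>2 = (((p\<^sub>2, c\<^sub>2), n\<^sub>1), k\<^sub>1)" using assms(8) eq by simp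
    \<comment> \<open>Equal values of R select the same base element, so the two values of S are
      \<open>V\<^sub>0\<^sub>1\<close> and \<open>V\<^sub>0\<^sub>2\<close> for common
      \<open>p\<^sub>0\<close> and \<open>c\<^sub>0\<close>.\<close>
    have "S_inv N P C pair K x\<^sub>0 x\<^sub>1 = S_inv N P C pair K x\<^sub>0 x\<^sub>2 \<longleftrightarrow>
        conjugate_in (ext_heisenberg N P C pair K) x\<^sub>1 x\<^sub>2"
      if "?r = R_inv N P C K x\<^sub>2"
      using V_set_eq_iff[of p\<^sub>0 p\<^sub>1 p\<^sub>2 c\<^sub>0 c\<^sub>1 c\<^sub>2] conjugate_in_ext_heisenberg_iff[of p\<^sub>1 p\<^sub>2 c\<^sub>1 c\<^sub>2] mem x\<^sub>0 that
      by (simp add: S_inv_def x\<^sub>2 assms(7))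
    \<comment> \<open>The witness \<open>a\<close> of the conjugacy criterion already shows that
      \<open>p\<^sub>1 - p\<^sub>2\<close> lies in Im \<Lambda>.\<close>
    moreover have "?r = R_inv N P C K x\<^sub>2"
      if "conjugate_in (ext_heisenberg N P C pair K) x\<^sub>1 x\<^sub>2"
      using that conjugate_in_ext_heisenberg_iff[of p\<^sub>1 p\<^sub>2 c\<^sub>1 c\<^sub>2] R_inv_eq_iff[of p\<^sub>1 p\<^sub>2 c\<^sub>1 c\<^sub>2] mem
      unfolding x\<^sub>2 assms(7) by blast
    ultimately show ?thesis by blast
  qed
  moreover have "n\<^sub>1 = n\<^sub>2" "k\<^sub>1 = k\<^sub>2"
    if "conjugate_in (ext_heisenberg N P C pair K) x\<^sub>1 x\<^sub>2"
    using conjugate_in_ext_heisenbergD[OF assms(5)] assms(9,10) that unfolding assms(7,8) by blast+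
  ultimately show ?thesis by blast
qed

end
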